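(* Let $n \in \mathbb{N}$, $A = C(S_n^+)$, and $C_H = 1 - \frac{1}{n} \sum_{i,j=1}^n u_{ij} \otimes u_{ij} \in (A \otimes A)_+$. Then, in $A \otimes A \otimes A \otimes A$, \[ \tilde{\Delta}(C_H) \leq \iota_{1,2}(C_H) + \iota_{3,4}(C_H). \]
   Context: $C(S_n^+)$ is the universal unital $\mathrm{C}^*$-algebra generated by elements $u_{ij}$, $1 \le i,j \le n$, subject to $u_{ij}^* = u_{ij} = u_{ij}^2$, $\sum_i u_{ij} = 1$ for each $j$, and $\sum_j u_{ij} = 1$ for each $i$. $\otimes$ is the minimal tensor product of $\mathrm{C}^*$-algebras. The comultiplication is the unital $*$-homomorphism $\Delta : A \to A \otimes A$ with $\Delta(u_{ij}) = \sum_{k=1}^n u_{ik} \otimes u_{kj}$. For distinct $i,j \in \{1,2,3,4\}$, $\iota_{i,j} : A \otimes A \to A^{\otimes 4}$ is the unital $*$-homomorphism putting the first tensor factor in leg $i$, the second in leg $j$, and $1$ in the other legs. The unital $*$-homomorphism $\tilde{\Delta} : A \otimes A \to A \otimes A \otimes A \otimes A$ is determined by \[ \tilde{\Delta}(a \otimes 1) = \iota_{1,3}(\Delta(a)), \qquad \tilde{\Delta}(1 \otimes a) = \iota_{2,4}(\Delta(a)), \qquad a \in A. \] Thus $\tilde\Delta(u_{ij} \otimes u_{ij}) = \sum_{k,l=1}^n u_{ik} \otimes u_{il} \otimes u_{kj} \otimes u_{lj}$. *)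

theory Defs
  imports "HOL-Analysis.Infinite_Sum" "HOL-Algebra.Module"
begin

section \<open>Unital C*-algebras\<close>

definition complex_ring :: "complex ring" where
  "complex_ring = \<lparr>carrier = UNIV, monoid.mult = (*), one = 1, zero = 0, add = (+)\<rparr>"

record 'a cstar = "(complex, 'a) module" +
  adj :: "'a \<Rightarrow> 'a"
  nrm :: "'a \<Rightarrow> real"

locale unital_cstar_algebra = module complex_ring A + ring A
  for A :: "'a cstar" (structure) +
  assumes smult_mult_left:
      "\<lbrakk>x \<in> carrier A; y \<in> carrier A\<rbrakk> \<Longrightarrow> (c \<odot> x) \<otimes> y = c \<odot> (x \<otimes> y)"
    and smult_mult_right:
      "\<lbrakk>x \<in> carrier A; y \<in> carrier A\<rbrakk> \<Longrightarrow> x \<otimes> (c \<odot> y) = c \<odot> (x \<otimes> y)"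
    and adj_closed: "x \<in> carrier A \<Longrightarrow> adj A x \<in> carrier A"
    and adj_adj: "x \<in> carrier A \<Longrightarrow> adj A (adj A x) = x"
    and adj_add:
      "\<lbrakk>x \<in> carrier A; y \<in> carrier A\<rbrakk> \<Longrightarrow> adj A (x \<oplus> y) = adj A x \<oplus> adj A y"
    and adj_smult: "x \<in> carrier A \<Longrightarrow> adj A (c \<odot> x) = cnj c \<odot> adj A x"
    and adj_mult:
      "\<lbrakk>x \<in> carrier A; y \<in> carrier A\<rbrakk> \<Longrightarrow> adj A (x \<otimes> y) = adj A y \<otimes> adj A x"
    and nrm_nonneg: "x \<in> carrier A \<Longrightarrow> 0 \<le> nrm A x"
    and nrm_eq_0_iff: "x \<in> carrier A \<Longrightarrow> nrm A x = 0 \<longleftrightarrow> x = \<zero>"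
    and nrm_triangle:
      "\<lbrakk>x \<in> carrier A; y \<in> carrier A\<rbrakk> \<Longrightarrow> nrm A (x \<oplus> y) \<le> nrm A x + nrm A y"
    and nrm_smult: "x \<in> carrier A \<Longrightarrow> nrm A (c \<odot> x) = cmod c * nrm A x"
    and nrm_mult:
      "\<lbrakk>x \<in> carrier A; y \<in> carrier A\<rbrakk> \<Longrightarrow> nrm A (x \<otimes> y) \<le> nrm A x * nrm A y"
    and cstar_identity: "x \<in> carrier A \<Longrightarrow> nrm A (adj A x \<otimes> x) = (nrm A x)\<^sup>2"
    and complete:
      "\<lbrakk>\<And>k. X k \<in> carrier A;
        \<And>e. 0 < e \<Longrightarrow> \<exists>N. \<forall>k\<ge>N. \<forall>l\<ge>N. nrm A (X k \<ominus> X l) < e\<rbrakk>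
       \<Longrightarrow> \<exists>x\<in>carrier A. (\<lambda>k. nrm A (X k \<ominus> x)) \<longlonglongrightarrow> 0"

text \<open>
  Positive elements are those of the form $z^* z$; the order is the usual one on the
  self-adjoint elements.
\<close>

definition cstar_pos :: "'a cstar \<Rightarrow> 'a set" where
  "cstar_pos A = {adj A z \<otimes>\<^bsub>A\<^esub> z | z. z \<in> carrier A}"

definition cstar_sa :: "'a cstar \<Rightarrow> 'a set" where
  "cstar_sa A = {x \<in> carrier A. adj A x = x}"

definition cstar_le :: "'a cstar \<Rightarrow> 'a \<Rightarrow> 'a \<Rightarrow> bool" where
  "cstar_le A x y \<longleftrightarrow> x \<in> cstar_sa A \<and> y \<in> cstar_sa A \<and> y \<ominus>\<^bsub>A\<^esub> x \<in> cstar_pos A"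

definition unital_star_hom :: "'a cstar \<Rightarrow> 'b cstar \<Rightarrow> ('a \<Rightarrow> 'b) \<Rightarrow> bool" where
  "unital_star_hom A B \<phi> \<longleftrightarrow>
     \<phi> \<in> ring_hom A B \<and>
     (\<forall>c. \<forall>x\<in>carrier A. \<phi> (c \<odot>\<^bsub>A\<^esub> x) = c \<odot>\<^bsub>B\<^esub> \<phi> x) \<and>
     (\<forall>x\<in>carrier A. \<phi> (adj A x) = adj B (\<phi> x))"

definition unital_cstar_subalgebra :: "'a set \<Rightarrow> 'a cstar \<Rightarrow> bool" where
  "unital_cstar_subalgebra S A \<longleftrightarrow>
     S \<subseteq> carrier A \<and> \<one>\<^bsub>A\<^esub> \<in> S \<and>
     (\<forall>x\<in>S. \<forall>y\<in>S. x \<oplus>\<^bsub>A\<^esub> y \<in> S \<and> x \<otimes>\<^bsub>A\<^esub> y \<in> S) \<and>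
     (\<forall>c. \<forall>x\<in>S. c \<odot>\<^bsub>A\<^esub> x \<in> S) \<and>
     (\<forall>x\<in>S. adj A x \<in> S) \<and>
     (\<forall>X. \<forall>x\<in>carrier A. (\<forall>k::nat. X k \<in> S) \<and> (\<lambda>k. nrm A (X k \<ominus>\<^bsub>A\<^esub> x)) \<longlonglongrightarrow> 0 \<longrightarrow> x \<in> S)"

definition cstar_generated_by :: "'a cstar \<Rightarrow> 'a set \<Rightarrow> bool" where
  "cstar_generated_by A G \<longleftrightarrow>
     G \<subseteq> carrier A \<and> (\<forall>S. unital_cstar_subalgebra S A \<and> G \<subseteq> S \<longrightarrow> S = carrier A)"


section \<open>The C*-algebra of the quantum permutation group\<close>

definition magic_unitary :: "nat \<Rightarrow> 'a cstar \<Rightarrow> (nat \<Rightarrow> nat \<Rightarrow> 'a) \<Rightarrow> bool" where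
  "magic_unitary n A u \<longleftrightarrow>
     (\<forall>i\<in>{1..n}. \<forall>j\<in>{1..n}.
        u i j \<in> carrier A \<and> adj A (u i j) = u i j \<and> u i j = u i j \<otimes>\<^bsub>A\<^esub> u i j) \<and>
     (\<forall>j\<in>{1..n}. (\<Oplus>\<^bsub>A\<^esub>i\<in>{1..n}. u i j) = \<one>\<^bsub>A\<^esub>) \<and>
     (\<forall>i\<in>{1..n}. (\<Oplus>\<^bsub>A\<^esub>j\<in>{1..n}. u i j) = \<one>\<^bsub>A\<^esub>)"

text \<open>
  The pair \<open>(A, u)\<close> is a model of $C(S_n^+)$ with its generators.
  The universal property is tested on C*-algebras whose carrier is a subset of the type
  \<^typ>\<open>real\<close> (with arbitrary operations, unrelated to the arithmetic of the reals). This
  is no restriction: the unital C*-subalgebra generated by a magic unitary \<open>v\<close> in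
  any C*-algebra is separable, so it has at most the cardinality of the continuum and an
  isomorphic copy of it lives on a subset of \<^typ>\<open>real\<close>. As \<open>A\<close> is
  generated by the \<open>u i j\<close>, the homomorphism is unique.
\<close>

definition is_C_Sn_plus :: "nat \<Rightarrow> 'a cstar \<Rightarrow> (nat \<Rightarrow> nat \<Rightarrow> 'a) \<Rightarrow> bool" where
  "is_C_Sn_plus n A u \<longleftrightarrow>
     unital_cstar_algebra A \<and> magic_unitary n A u \<and>
     cstar_generated_by A {u i j | i j. i \<in> {1..n} \<and> j \<in> {1..n}} \<and>
     (\<forall>(B :: real cstar) v. unital_cstar_algebra B \<and> magic_unitary n B v \<longrightarrow>
        (\<exists>\<phi>. unital_star_hom A B \<phi> \<and> (\<forall>i\<in>{1..n}. \<forall>j\<in>{1..n}. \<phi> (u i j) = v i j)))"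


section \<open>Representations on Hilbert spaces and the minimal tensor product\<close>

definition ell2 :: "('i \<Rightarrow> complex) set" where
  "ell2 = {x. (\<lambda>i. (cmod (x i))\<^sup>2) summable_on UNIV}"

definition ell2_norm :: "('i \<Rightarrow> complex) \<Rightarrow> real" where
  "ell2_norm x = sqrt (\<Sum>\<^sub>\<infinity>i. (cmod (x i))\<^sup>2)"

definition ell2_inner :: "('i \<Rightarrow> complex) \<Rightarrow> ('i \<Rightarrow> complex) \<Rightarrow> complex" where
  "ell2_inner x y = (\<Sum>\<^sub>\<infinity>i. cnj (x i) * y i)"

definition ell2_bounded_op :: "(('i \<Rightarrow> complex) \<Rightarrow> ('i \<Rightarrow> complex)) \<Rightarrow> bool" where
  "ell2_bounded_op T \<longleftrightarrow>
     (\<forall>x\<in>ell2. T x \<in> ell2) \<and>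
     (\<forall>x\<in>ell2. \<forall>y\<in>ell2. T (\<lambda>i. x i + y i) = (\<lambda>i. T x i + T y i)) \<and>
     (\<forall>c. \<forall>x\<in>ell2. T (\<lambda>i. c * x i) = (\<lambda>i. c * T x i)) \<and>
     (\<exists>C. \<forall>x\<in>ell2. ell2_norm (T x) \<le> C * ell2_norm x)"

definition ell2_op_norm :: "(('i \<Rightarrow> complex) \<Rightarrow> ('i \<Rightarrow> complex)) \<Rightarrow> real" where
  "ell2_op_norm T = (SUP x \<in> {x \<in> ell2. ell2_norm x \<le> 1}. ell2_norm (T x))"

text \<open>
  Faithful *-representations. A *-homomorphism between C*-algebras is injective iff it is
  isometric; faithfulness is stated in the isometric form, which identifies \<open>A\<close>
  with a norm-closed *-subalgebra of the bounded operators. The values of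
  \<open>\<pi> a\<close> outside \<^const>\<open>ell2\<close> are irrelevant.
\<close>

definition faithful_rep :: "'a cstar \<Rightarrow> ('a \<Rightarrow> ('i \<Rightarrow> complex) \<Rightarrow> ('i \<Rightarrow> complex)) \<Rightarrow> bool" where
  "faithful_rep A \<pi> \<longleftrightarrow>
     (\<forall>a\<in>carrier A. ell2_bounded_op (\<pi> a) \<and> ell2_op_norm (\<pi> a) = nrm A a) \<and>
     (\<forall>a\<in>carrier A. \<forall>b\<in>carrier A. \<forall>x\<in>ell2.
        \<pi> (a \<oplus>\<^bsub>A\<^esub> b) x = (\<lambda>i. \<pi> a x i + \<pi> b x i) \<and> \<pi> (a \<otimes>\<^bsub>A\<^esub> b) x = \<pi> a (\<pi> b x)) \<and>
     (\<forall>c. \<forall>a\<in>carrier A. \<forall>x\<in>ell2. \<pi> (c \<odot>\<^bsub>A\<^esub> a) x = (\<lambda>i. c * \<pi> a x i)) \<and>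
     (\<forall>a\<in>carrier A. \<forall>x\<in>ell2. \<forall>y\<in>ell2.
        ell2_inner (\<pi> (adj A a) x) y = ell2_inner x (\<pi> a y))"

text \<open>
  \<open>T\<close>, with the bilinear map \<open>t\<close>, is the minimal (spatial) tensor product
  of \<open>A\<close> and \<open>B\<close>: for faithful representations of \<open>A\<close> on
  $H$ and of \<open>B\<close> on $K$ it is (isomorphic to) the closed linear span of the operators
  $\pi(a) \otimes \rho(b)$ on $H \otimes K$, where
  $\ell^2(I) \otimes \ell^2(J) = \ell^2(I \times J)$. The result does not depend on the
  faithful representations. The carrier types of \<open>A\<close> and \<open>B\<close> serve as
  index sets $I$ and $J$; they are large enough, since a C*-algebra has a faithful
  representation on a Hilbert space whose dimension is the cardinality of any given
  infinite set that has at least as many elements as the algebra.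
\<close>

definition is_min_tensor ::
    "'a cstar \<Rightarrow> 'b cstar \<Rightarrow> 'c cstar \<Rightarrow> ('a \<Rightarrow> 'b \<Rightarrow> 'c) \<Rightarrow> bool" where
  "is_min_tensor A B T t \<longleftrightarrow>
     unital_cstar_algebra T \<and>
     (\<forall>a\<in>carrier A. \<forall>b\<in>carrier B. t a b \<in> carrier T) \<and>
     (\<forall>a\<in>carrier A. \<forall>a'\<in>carrier A. \<forall>b\<in>carrier B. t (a \<oplus>\<^bsub>A\<^esub> a') b = t a b \<oplus>\<^bsub>T\<^esub> t a' b) \<and>
     (\<forall>a\<in>carrier A. \<forall>b\<in>carrier B. \<forall>b'\<in>carrier B. t a (b \<oplus>\<^bsub>B\<^esub> b') = t a b \<oplus>\<^bsub>T\<^esub> t a b') \<and>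
     (\<forall>c. \<forall>a\<in>carrier A. \<forall>b\<in>carrier B.
        t (c \<odot>\<^bsub>A\<^esub> a) b = c \<odot>\<^bsub>T\<^esub> t a b \<and> t a (c \<odot>\<^bsub>B\<^esub> b) = c \<odot>\<^bsub>T\<^esub> t a b) \<and>
     (\<forall>a\<in>carrier A. \<forall>a'\<in>carrier A. \<forall>b\<in>carrier B. \<forall>b'\<in>carrier B.
        t (a \<otimes>\<^bsub>A\<^esub> a') (b \<otimes>\<^bsub>B\<^esub> b') = t a b \<otimes>\<^bsub>T\<^esub> t a' b') \<and>
     (\<forall>a\<in>carrier A. \<forall>b\<in>carrier B. t (adj A a) (adj B b) = adj T (t a b)) \<and>
     t \<one>\<^bsub>A\<^esub> \<one>\<^bsub>B\<^esub> = \<one>\<^bsub>T\<^esub> \<and>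
     (\<forall>x\<in>carrier T. \<forall>e>0. \<exists>(m::nat) a b.
        (\<forall>k<m. a k \<in> carrier A \<and> b k \<in> carrier B) \<and>
        nrm T (x \<ominus>\<^bsub>T\<^esub> (\<Oplus>\<^bsub>T\<^esub>k\<in>{..<m}. t (a k) (b k))) < e) \<and>
     (\<exists>(\<pi> :: 'a \<Rightarrow> ('a \<Rightarrow> complex) \<Rightarrow> ('a \<Rightarrow> complex))
       (\<rho> :: 'b \<Rightarrow> ('b \<Rightarrow> complex) \<Rightarrow> ('b \<Rightarrow> complex))
       (\<sigma> :: 'c \<Rightarrow> ('a \<times> 'b \<Rightarrow> complex) \<Rightarrow> ('a \<times> 'b \<Rightarrow> complex)).
        faithful_rep A \<pi> \<and> faithful_rep B \<rho> \<and> faithful_rep T \<sigma> \<and>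
        (\<forall>a\<in>carrier A. \<forall>b\<in>carrier B. \<forall>x\<in>ell2. \<forall>y\<in>ell2.
           \<sigma> (t a b) (\<lambda>(i, j). x i * y j) = (\<lambda>(i, j). \<pi> a x i * \<rho> b y j)))"


section \<open>Comultiplication and leg embeddings\<close>

text \<open>
  Below, \<open>A2\<close> with \<open>t\<close> is $A \otimes A$, and \<open>A4\<close> with \<open>s\<close> is
  $A \otimes A \otimes A \otimes A$, bracketed as $(A \otimes A) \otimes (A \otimes A)$.
\<close>

definition tensor4 :: "('a \<Rightarrow> 'a \<Rightarrow> 'c) \<Rightarrow> ('c \<Rightarrow> 'c \<Rightarrow> 'd) \<Rightarrow> (nat \<Rightarrow> 'a) \<Rightarrow> 'd" where
  "tensor4 t s f = s (t (f 1) (f 2)) (t (f 3) (f 4))"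

text \<open>
  The *-homomorphisms below are pinned down on the carrier of their domain by the stated
  values, because these generate the domain as a C*-algebra.
\<close>

definition is_comultiplication ::
    "nat \<Rightarrow> 'a cstar \<Rightarrow> (nat \<Rightarrow> nat \<Rightarrow> 'a) \<Rightarrow> 'c cstar \<Rightarrow> ('a \<Rightarrow> 'a \<Rightarrow> 'c) \<Rightarrow> ('a \<Rightarrow> 'c) \<Rightarrow> bool" where
  "is_comultiplication n A u A2 t \<Delta> \<longleftrightarrow>
     unital_star_hom A A2 \<Delta> \<and>
     (\<forall>i\<in>{1..n}. \<forall>j\<in>{1..n}. \<Delta> (u i j) = (\<Oplus>\<^bsub>A2\<^esub>k\<in>{1..n}. t (u i k) (u k j)))"

definition are_leg_embeddings ::
    "'a cstar \<Rightarrow> 'c cstar \<Rightarrow> ('a \<Rightarrow> 'a \<Rightarrow> 'c) \<Rightarrow> 'd cstar \<Rightarrow> ('c \<Rightarrow> 'c \<Rightarrow> 'd) \<Rightarrow>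
      (nat \<Rightarrow> nat \<Rightarrow> 'c \<Rightarrow> 'd) \<Rightarrow> bool" where
  "are_leg_embeddings A A2 t A4 s \<iota> \<longleftrightarrow>
     (\<forall>i\<in>{1..4}. \<forall>j\<in>{1..4}. i \<noteq> j \<longrightarrow>
        unital_star_hom A2 A4 (\<iota> i j) \<and>
        (\<forall>a\<in>carrier A. \<forall>b\<in>carrier A.
           \<iota> i j (t a b) =
             tensor4 t s (\<lambda>m. if m = i then a else if m = j then b else \<one>\<^bsub>A\<^esub>)))"

definition is_Delta_tilde ::
    "'a cstar \<Rightarrow> 'c cstar \<Rightarrow> ('a \<Rightarrow> 'a \<Rightarrow> 'c) \<Rightarrow> 'd cstar \<Rightarrow> ('a \<Rightarrow> 'c) \<Rightarrow>
      (nat \<Rightarrow> nat \<Rightarrow> 'c \<Rightarrow> 'd) \<Rightarrow> ('c \<Rightarrow> 'd) \<Rightarrow> bool" where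
  "is_Delta_tilde A A2 t A4 \<Delta> \<iota> \<Delta>t \<longleftrightarrow>
     unital_star_hom A2 A4 \<Delta>t \<and>
     (\<forall>a\<in>carrier A. \<Delta>t (t a \<one>\<^bsub>A\<^esub>) = \<iota> 1 3 (\<Delta> a) \<and> \<Delta>t (t \<one>\<^bsub>A\<^esub> a) = \<iota> 2 4 (\<Delta> a))"

definition C_H :: "nat \<Rightarrow> (nat \<Rightarrow> nat \<Rightarrow> 'a) \<Rightarrow> 'c cstar \<Rightarrow> ('a \<Rightarrow> 'a \<Rightarrow> 'c) \<Rightarrow> 'c" where
  "C_H n u A2 t =
     \<one>\<^bsub>A2\<^esub> \<ominus>\<^bsub>A2\<^esub>
       (1 / of_nat n) \<odot>\<^bsub>A2\<^esub> (\<Oplus>\<^bsub>A2\<^esub>i\<in>{1..n}. \<Oplus>\<^bsub>A2\<^esub>j\<in>{1..n}. t (u i j) (u i j))"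

end

theory Submission
  imports Defs
begin

text \<open>
  Put $E_{kl} = \sum_i u_{ik} \otimes u_{il}$ and $F_{kl} = \sum_j u_{kj} \otimes u_{lj}$. These are
  projections, since the entries in a row or a column of \<open>u\<close> are mutually orthogonal, and
  $\sum_{i,j} u_{ij} \otimes u_{ij} = \sum_k E_{kk} = \sum_k F_{kk}$. So $C_H = \frac1n \sum_k (1 - F_{kk})$ is
  positive. Moreover $\tilde\Delta(\sum_{i,j} u_{ij} \otimes u_{ij}) = \sum_{k,l} E_{kl} \otimes F_{kl}$, hence
  \[ \iota_{1,2}(C_H) + \iota_{3,4}(C_H) - \tilde\Delta(C_H)
     = \frac1n \sum_k \Bigl( (1 - E_{kk}) \otimes (1 - F_{kk}) + \sum_{l \ne k} E_{kl} \otimes F_{kl} \Bigr), \]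
  a sum of projections with positive coefficients.
\<close>

text \<open>Two steps that usually rest on spectral theory are obtained without it. Positivity means
  having the form z* z, and a sum of projections with positive coefficients is not visibly of that
  form. Such sums are placed in a norm-defined cone that is closed under addition, and a square root
  built by iteration leads from this cone back to z* z. The orthogonality within a row or column is
  deduced from its sum being 1: in the faithful representation that comes with the minimal tensor
  product, a vanishing sum of elements x_i* x_i forces every x_i to vanish. Writing C_H in two ways
  is what makes the difference factor. With E_kk in legs 1, 2 and F_kk in legs 3, 4, the expression
  1 - E_kk \<otimes> 1 - 1 \<otimes> F_kk lacks only E_kk \<otimes> F_kk to be a product of
  complements, and this is the term l = k of the sum for the comultiplication.\<close>

lemma complex_ring_simps [simp]:
  "carrier complex_ring = UNIV" "x \<otimes>\<^bsub>complex_ring\<^esub> y = x * y" "\<one>\<^bsub>complex_ring\<^esub> = 1"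
  "\<zero>\<^bsub>complex_ring\<^esub> = 0" "x \<oplus>\<^bsub>complex_ring\<^esub> y = x + y"
  by (simp_all add: complex_ring_def)

section \<open>Arithmetic of scalars, adjoints and norms in a unital C*-algebra\<close>

context unital_cstar_algebra
begin

lemma complex_ring_minus [simp]: "\<ominus>\<^bsub>complex_ring\<^esub> c = - c"
  using R.l_neg[of c] by (simp add: eq_neg_iff_add_eq_0)

lemma scale_closed [simp, intro]: "x \<in> carrier A \<Longrightarrow> c \<odot> x \<in> carrier A"
  by simp

lemma scale_simps:
  assumes "x \<in> carrier A"
  shows "1 \<odot> x = x" "0 \<odot> x = \<zero>" "c \<odot> \<zero> = \<zero>" "(- c) \<odot> x = \<ominus> (c \<odot> x)"
    "c \<odot> (d \<odot> x) = (c * d) \<odot> x" "(c + d) \<odot> x = c \<odot> x \<oplus> d \<odot> x" "c \<odot> (\<ominus> x) = \<ominus> (c \<odot> x)"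
  using assms smult_one[of x] smult_l_null[of x] smult_r_null[of c] smult_l_minus[of c x]
    smult_assoc1[of c d x] smult_l_distr[of c d x] smult_r_minus[of c x] by simp_all

lemma scale_minus: "x \<in> carrier A \<Longrightarrow> y \<in> carrier A \<Longrightarrow> c \<odot> (x \<ominus> y) = c \<odot> x \<ominus> c \<odot> y"
  by (simp add: a_minus_def smult_r_distr scale_simps)

lemma scale_add: "x \<in> carrier A \<Longrightarrow> y \<in> carrier A \<Longrightarrow> c \<odot> (x \<oplus> y) = c \<odot> x \<oplus> c \<odot> y"
  by (simp add: smult_r_distr)

lemma adj_zero [simp]: "adj A \<zero> = \<zero>"
  using adj_smult[of \<zero> 0] by (simp add: scale_simps adj_closed)

text \<open>Taking adjoints in 1* 1 = 1* turns the left side into 1* 1 = 1* and the right side into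
  1.\<close>

lemma adj_one [simp]: "adj A \<one> = \<one>"
  using adj_mult[of "adj A \<one>" \<one>] by (simp add: adj_closed adj_adj)

lemma adj_uminus: "x \<in> carrier A \<Longrightarrow> adj A (\<ominus> x) = \<ominus> adj A x"
  using adj_smult[of x "-1"] by (simp add: scale_simps adj_closed)

lemma adj_minus: "x \<in> carrier A \<Longrightarrow> y \<in> carrier A \<Longrightarrow> adj A (x \<ominus> y) = adj A x \<ominus> adj A y"
  by (simp add: a_minus_def adj_add adj_uminus adj_closed)

lemma nrm_uminus: "x \<in> carrier A \<Longrightarrow> nrm A (\<ominus> x) = nrm A x"
  using nrm_smult[of x "-1"] by (simp add: scale_simps)

lemma nrm_minus_commute: "x \<in> carrier A \<Longrightarrow> y \<in> carrier A \<Longrightarrow> nrm A (x \<ominus> y) = nrm A (y \<ominus> x)"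
  using nrm_uminus[of "x \<ominus> y"] by (simp add: a_minus_def M.minus_add M.a_comm)

lemma nrm_minus_triangle:
  assumes "x \<in> carrier A" "y \<in> carrier A" "z \<in> carrier A"
  shows "nrm A (x \<ominus> z) \<le> nrm A (x \<ominus> y) + nrm A (y \<ominus> z)"
proof -
  have "x \<ominus> z = (x \<ominus> y) \<oplus> (y \<ominus> z)"
    using assms by algebra
  then show ?thesis using assms nrm_triangle[of "x \<ominus> y" "y \<ominus> z"] by simp
qed

lemma nrm_zero [simp]: "nrm A \<zero> = 0"
  by (simp add: nrm_eq_0_iff)

text \<open>The C*-identity gives |y|^2 = |y* y| \<le> |y*| |y|, hence |y| \<le> |y*| after
  cancelling. Applying this to x and to its adjoint yields equality.\<close>

lemma nrm_adj: assumes "x \<in> carrier A" shows "nrm A (adj A x) = nrm A x"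
proof -
  have le: "nrm A y \<le> nrm A (adj A y)" if "y \<in> carrier A" for y
  proof (cases "nrm A y = 0")
    case False
    have "nrm A y * nrm A y \<le> nrm A (adj A y) * nrm A y"
      using cstar_identity[OF that] nrm_mult[of "adj A y" y] that
      by (simp add: adj_closed power2_eq_square)
    then show ?thesis using False nrm_nonneg[OF that] by simp
  qed (use that nrm_nonneg adj_closed in simp)
  show ?thesis using le[OF assms] le[of "adj A x"] assms by (simp add: adj_closed adj_adj)
qed

section \<open>Limits, and a square root of 1 - y\<close>

text \<open>Used to carry identities of the iterates, self-adjointness and the recursion, over to
  their limit.\<close>

lemma limit_unique:
  assumes "\<And>k. X k \<in> carrier A" "a \<in> carrier A" "b \<in> carrier A"
    and "(\<lambda>k. nrm A (X k \<ominus> a)) \<longlonglongrightarrow> 0" "(\<lambda>k. nrm A (X k \<ominus> b)) \<longlonglongrightarrow> 0"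
  shows "a = b"
proof -
  have "nrm A (a \<ominus> b) \<le> nrm A (X k \<ominus> a) + nrm A (X k \<ominus> b)" for k
    using nrm_minus_triangle[of a "X k" b] nrm_minus_commute[of a "X k"] assms by simp
  moreover have "(\<lambda>k. nrm A (X k \<ominus> a) + nrm A (X k \<ominus> b)) \<longlonglongrightarrow> 0"
    using tendsto_add[OF assms(4,5)] by simp
  ultimately have "nrm A (a \<ominus> b) \<le> 0"
    by (meson LIMSEQ_le_const)
  then have "a \<ominus> b = \<zero>"
    using assms nrm_nonneg[of "a \<ominus> b"] nrm_eq_0_iff[of "a \<ominus> b"] by simp
  moreover have "a = (a \<ominus> b) \<oplus> b"
    using assms by algebra
  ultimately show ?thesis
    using assms by simp
qed

text \<open>The splitting a a - b b = (a - b) a + b (a - b) does not require a and b to commute. The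
  bound controls both the increments of the iteration and the passage to the limit.\<close>

lemma nrm_square_diff:
  assumes "a \<in> carrier A" "b \<in> carrier A"
  shows "nrm A (a \<otimes> a \<ominus> b \<otimes> b) \<le> nrm A (a \<ominus> b) * (nrm A a + nrm A b)"
proof -
  have "a \<otimes> a \<ominus> b \<otimes> b = (a \<ominus> b) \<otimes> a \<oplus> b \<otimes> (a \<ominus> b)"
    using assms by algebra
  also have "nrm A \<dots> \<le> nrm A ((a \<ominus> b) \<otimes> a) + nrm A (b \<otimes> (a \<ominus> b))"
    using assms by (intro nrm_triangle) auto
  also have "\<dots> \<le> nrm A (a \<ominus> b) * nrm A a + nrm A b * nrm A (a \<ominus> b)"
    using assms by (intro add_mono nrm_mult) auto
  finally show ?thesis by (simp add: algebra_simps)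
qed

text \<open>
  The iterates $z_{k+1} = (y + z_k^2)/2$ converge to $z = 1 - \sqrt{1-y}$; they are dominated by the
  scalar iteration $r_{k+1} = (1 + r_k^2)/2$, in norm and in the norm of their increments.
\<close>

lemma one_minus_in_cstar_pos:
  assumes y: "y \<in> carrier A" and sa: "adj A y = y" and le1: "nrm A y \<le> 1"
  shows "\<one> \<ominus> y \<in> cstar_pos A"
proof -
  define r :: "nat \<Rightarrow> real" where "r = rec_nat 0 (\<lambda>_ x. (1 + x\<^sup>2) / 2)"
  define z where "z = rec_nat \<zero> (\<lambda>_ x. (1/2) \<odot> (y \<oplus> x \<otimes> x))"
  have r_Suc: "r (Suc k) = (1 + (r k)\<^sup>2) / 2" and r_0: "r 0 = 0" for k
    by (simp_all add: r_def)
  have z_Suc: "z (Suc k) = (1/2) \<odot> (y \<oplus> z k \<otimes> z k)" and z_0: "z 0 = \<zero>" for k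
    by (simp_all add: z_def)
  have r_bounds: "0 \<le> r k \<and> r k \<le> 1" for k
    by (induction k) (auto simp: r_Suc r_0 power_le_one)
  have z_carrier [simp]: "z k \<in> carrier A" for k
    by (induction k) (auto simp: z_Suc z_0 y)
  have z_sa: "adj A (z k) = z k" for k
    by (induction k) (auto simp: z_Suc z_0 y adj_smult adj_add adj_mult sa)
  have half: "nrm A ((1/2) \<odot> x) = nrm A x / 2" if "x \<in> carrier A" for x
    using that by (simp add: nrm_smult norm_divide)
  have z_le: "nrm A (z k) \<le> r k" for k
  proof (induction k)
    case (Suc k)
    have "nrm A (y \<oplus> z k \<otimes> z k) \<le> nrm A y + nrm A (z k) * nrm A (z k)"
      using nrm_triangle[of y "z k \<otimes> z k"] nrm_mult[of "z k" "z k"] y by simp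
    also have "\<dots> \<le> 1 + r k * r k"
      using Suc le1 r_bounds[of k] nrm_nonneg[of "z k"] by (intro add_mono mult_mono) auto
    finally show ?case by (simp add: z_Suc r_Suc half y power2_eq_square)
  qed (simp add: z_0 r_0)
  \<comment> \<open>The constant term y cancels, so differences of iterates depend only on
    differences of squares.\<close>
  have step: "(1/2) \<odot> (y \<oplus> a \<otimes> a) \<ominus> (1/2) \<odot> (y \<oplus> b \<otimes> b) = (1/2) \<odot> (a \<otimes> a \<ominus> b \<otimes> b)"
    if "a \<in> carrier A" "b \<in> carrier A" for a b
  proof -
    have "(y \<oplus> a \<otimes> a) \<ominus> (y \<oplus> b \<otimes> b) = a \<otimes> a \<ominus> b \<otimes> b"
      using that y by algebra
    then show ?thesis using that y by (metis scale_minus M.add.m_closed m_closed)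
  qed
  have z_diff: "nrm A (z (Suc k) \<ominus> z k) \<le> r (Suc k) - r k" for k
  proof (induction k)
    case 0
    show ?case using z_le[of 1] by (simp add: z_0 r_0 a_minus_def)
  next
    case (Suc k)
    have "nrm A (z (Suc (Suc k)) \<ominus> z (Suc k)) = nrm A (z (Suc k) \<otimes> z (Suc k) \<ominus> z k \<otimes> z k) / 2"
      using step[OF z_carrier z_carrier, of "Suc k" k] half[of "z (Suc k) \<otimes> z (Suc k) \<ominus> z k \<otimes> z k"]
      by (simp flip: z_Suc)
    also have "\<dots> \<le> nrm A (z (Suc k) \<ominus> z k) * (nrm A (z (Suc k)) + nrm A (z k)) / 2"
      using nrm_square_diff[of "z (Suc k)" "z k"] by simp
    also have "\<dots> \<le> (r (Suc k) - r k) * (r (Suc k) + r k) / 2"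
      using Suc z_le[of k] z_le[of "Suc k"] nrm_nonneg[of "z (Suc k) \<ominus> z k"]
        nrm_nonneg[of "z k"] nrm_nonneg[of "z (Suc k)"]
      by (intro divide_right_mono mult_mono add_mono) auto
    \<comment> \<open>The product is a difference of two squares, and half of it is exactly the next
      increment of the scalar recursion.\<close>
    also have "\<dots> = r (Suc (Suc k)) - r (Suc k)"
      unfolding r_Suc[of "Suc k"] using r_Suc[of k] by (simp add: field_simps power2_eq_square)
    finally show ?case .
  qed
  have z_diff': "nrm A (z (k + m) \<ominus> z k) \<le> r (k + m) - r k" for k m
  proof (induction m)
    case (Suc m)
    show ?case using nrm_minus_triangle[of "z (k + Suc m)" "z (k + m)" "z k"] z_diff[of "k + m"] Suc
      by simp
  qed (simp add: a_minus_def M.r_neg)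
  \<comment> \<open>Each increment of \<open>r\<close> dominates a norm and is therefore
    nonnegative. The value of the limit of \<open>r\<close> plays no part below.\<close>
  have "incseq r"
    using order_trans[OF nrm_nonneg z_diff] by (intro incseq_SucI) auto
  then obtain L where "r \<longlonglongrightarrow> L"
    using incseq_convergent[of r 1] r_bounds by blast
  then have "Cauchy r"
    by (blast intro: LIMSEQ_imp_Cauchy)
  have "\<exists>x\<in>carrier A. (\<lambda>k. nrm A (z k \<ominus> x)) \<longlonglongrightarrow> 0"
  proof (rule complete)
    fix e :: real assume "0 < e"
    then obtain N where N: "\<And>k l. k \<ge> N \<Longrightarrow> l \<ge> N \<Longrightarrow> \<bar>r k - r l\<bar> < e"
      using \<open>Cauchy r\<close> unfolding Cauchy_def dist_real_def by blast
    have "nrm A (z k \<ominus> z l) < e" if "k \<ge> N" "l \<ge> N" for k l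
    proof (cases "l \<le> k")
      case True
      then show ?thesis using z_diff'[of l "k - l"] N[OF that] by simp
    next
      case False
      then show ?thesis using z_diff'[of k "l - k"] N[OF that] nrm_minus_commute[of "z k" "z l"]
        by simp
    qed
    then show "\<exists>N. \<forall>k\<ge>N. \<forall>l\<ge>N. nrm A (z k \<ominus> z l) < e" by blast
  qed simp
  then obtain x where x: "x \<in> carrier A" and lim: "(\<lambda>k. nrm A (z k \<ominus> x)) \<longlonglongrightarrow> 0" by blast
  have "adj A x = x"
  proof (rule limit_unique[of z])
    have "nrm A (z k \<ominus> adj A x) = nrm A (z k \<ominus> x)" for k
      using nrm_adj[of "z k \<ominus> x"] x by (simp add: adj_minus z_sa)
    then show "(\<lambda>k. nrm A (z k \<ominus> adj A x)) \<longlonglongrightarrow> 0" using lim by simp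
  qed (use x lim adj_closed in auto)
  \<comment> \<open>The shifted iterates tend to x, and, since squaring is continuous along the
    bounded sequence, also to the right-hand side.\<close>
  have x_eq: "x = (1/2) \<odot> (y \<oplus> x \<otimes> x)"
  proof (rule limit_unique[of "\<lambda>k. z (Suc k)"])
    show "(\<lambda>k. nrm A (z (Suc k) \<ominus> x)) \<longlonglongrightarrow> 0"
      using lim by (rule LIMSEQ_Suc)
    have "nrm A (z (Suc k) \<ominus> (1/2) \<odot> (y \<oplus> x \<otimes> x)) \<le> nrm A (z k \<ominus> x) * (1 + nrm A x)" for k
    proof -
      have "nrm A (z (Suc k) \<ominus> (1/2) \<odot> (y \<oplus> x \<otimes> x)) = nrm A (z k \<otimes> z k \<ominus> x \<otimes> x) / 2"
        using step[of "z k" x] half x by (simp add: z_Suc)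
      also have "\<dots> \<le> nrm A (z k \<otimes> z k \<ominus> x \<otimes> x)"
        using nrm_nonneg[of "z k \<otimes> z k \<ominus> x \<otimes> x"] x by simp
      also have "\<dots> \<le> nrm A (z k \<ominus> x) * (nrm A (z k) + nrm A x)"
        using x by (intro nrm_square_diff) auto
      also have "\<dots> \<le> nrm A (z k \<ominus> x) * (1 + nrm A x)"
        using x z_le[of k] r_bounds[of k] nrm_nonneg[of "z k \<ominus> x"] by (intro mult_left_mono) auto
      finally show ?thesis .
    qed
    moreover have "(\<lambda>k. nrm A (z k \<ominus> x) * (1 + nrm A x)) \<longlonglongrightarrow> 0"
      using tendsto_mult_left_zero[OF lim] .
    ultimately show "(\<lambda>k. nrm A (z (Suc k) \<ominus> (1/2) \<odot> (y \<oplus> x \<otimes> x))) \<longlonglongrightarrow> 0"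
      by (rule tendsto_sandwich[OF eventuallyI eventuallyI tendsto_const, rotated])
        (rule nrm_nonneg, use x y in simp)
  qed (use x y in auto)
  \<comment> \<open>The fixed-point equation reads y = 2x - x^2, so 1 - y is the square of the
    self-adjoint element 1 - x.\<close>
  have "x \<oplus> x = 2 \<odot> x"
    using x smult_l_distr[of 1 1 x] by (simp add: scale_simps)
  also have "\<dots> = y \<oplus> x \<otimes> x"
    using x y by (subst x_eq) (simp add: scale_simps)
  finally have "y = (x \<oplus> x) \<ominus> x \<otimes> x"
    using x y by algebra
  then have "\<one> \<ominus> y = (\<one> \<ominus> x) \<otimes> (\<one> \<ominus> x)"
    using x by (simp only:) (algebra, simp)
  also have "\<dots> = adj A (\<one> \<ominus> x) \<otimes> (\<one> \<ominus> x)"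
    using x \<open>adj A x = x\<close> by (simp add: adj_minus)
  finally show ?thesis
    unfolding cstar_pos_def using x by blast
qed

section \<open>A norm description of positivity\<close>

text \<open>
  The condition $\|M \cdot 1 - x\| \le M$ describes the positive cone without reference to spectra.
  It is visibly stable under sums, which is not clear for elements of the form $z^* z$.
\<close>

definition order_unit_bounded :: "'a set" where
  "order_unit_bounded = {x \<in> cstar_sa A. \<exists>M\<ge>0. nrm A (of_real M \<odot> \<one> \<ominus> x) \<le> M}"

lemma order_unit_bounded_carrier: "x \<in> order_unit_bounded \<Longrightarrow> x \<in> carrier A"
  by (simp add: order_unit_bounded_def cstar_sa_def)

lemma order_unit_bounded_sa: "x \<in> order_unit_bounded \<Longrightarrow> x \<in> cstar_sa A"
  by (simp add: order_unit_bounded_def)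

text \<open>With c = sqrt M this absorbs a positive factor M into z.\<close>

lemma scale_adj_mult:
  assumes "z \<in> carrier A"
  shows "adj A (of_real c \<odot> z) \<otimes> (of_real c \<odot> z) = of_real (c\<^sup>2) \<odot> (adj A z \<otimes> z)"
  using assms
  by (simp add: adj_smult smult_mult_left smult_mult_right adj_closed scale_simps power2_eq_square)

text \<open>Division by M turns the bound into |1 - x/M| \<le> 1. Hence y = 1 - x/M admits a square
  root of 1 - y = x/M, and the factor M is put back as sqrt M.\<close>

lemma order_unit_bounded_subset_cstar_pos: "order_unit_bounded \<subseteq> cstar_pos A"
proof
  fix x assume "x \<in> order_unit_bounded"
  then obtain M where x: "x \<in> carrier A" "adj A x = x" and "M \<ge> 0"
    and M: "nrm A (of_real M \<odot> \<one> \<ominus> x) \<le> M"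
    by (auto simp: order_unit_bounded_def cstar_sa_def)
  show "x \<in> cstar_pos A"
  proof (cases "M = 0")
    \<comment> \<open>Here the bound says |x| \<le> 0, so x = 0 and z = 0 serves as witness.\<close>
    case True
    then have "nrm A x = 0"
      using M x nrm_nonneg[of x] by (simp add: scale_simps a_minus_def nrm_uminus)
    then have "x = adj A \<zero> \<otimes> \<zero>"
      using x by (simp add: nrm_eq_0_iff)
    then show ?thesis unfolding cstar_pos_def by blast
  next
    case False
    then have "M > 0" using \<open>M \<ge> 0\<close> by simp
    define c where "c = complex_of_real (1 / M)"
    have cM: "c * of_real M = 1" using \<open>M > 0\<close> by (simp add: c_def)
    define y where "y = \<one> \<ominus> c \<odot> x"
    have "y = c \<odot> (of_real M \<odot> \<one> \<ominus> x)"
      using x cM by (simp add: y_def scale_minus scale_simps)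
    then have "nrm A y = (1 / M) * nrm A (of_real M \<odot> \<one> \<ominus> x)"
      using x \<open>M > 0\<close> by (simp add: nrm_smult c_def norm_divide)
    also have "\<dots> \<le> 1" using M \<open>M > 0\<close> by simp
    finally have "\<one> \<ominus> y \<in> cstar_pos A"
      using x by (intro one_minus_in_cstar_pos) (auto simp: y_def adj_minus adj_smult c_def)
    moreover have "\<one> \<ominus> y = c \<odot> x"
    proof -
      have "\<one> \<ominus> (\<one> \<ominus> w) = w" if "w \<in> carrier A" for w
        using that by algebra
      then show ?thesis using x by (simp add: y_def)
    qed
    ultimately obtain w where w: "w \<in> carrier A" "c \<odot> x = adj A w \<otimes> w"
      by (auto simp: cstar_pos_def)
    have "x = of_real M \<odot> (c \<odot> x)"
      using x cM by (simp add: scale_simps mult.commute)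
    also have "\<dots> = adj A (of_real (sqrt M) \<odot> w) \<otimes> (of_real (sqrt M) \<odot> w)"
      using scale_adj_mult[of w "sqrt M"] w \<open>M > 0\<close> by simp
    finally show ?thesis unfolding cstar_pos_def using w(1) by blast
  qed
qed

lemma order_unit_bounded_add:
  assumes "x \<in> order_unit_bounded" "y \<in> order_unit_bounded"
  shows "x \<oplus> y \<in> order_unit_bounded"
proof -
  obtain M where x: "x \<in> carrier A" "adj A x = x" and "M \<ge> 0"
    and M: "nrm A (of_real M \<odot> \<one> \<ominus> x) \<le> M"
    using assms(1) by (auto simp: order_unit_bounded_def cstar_sa_def)
  obtain N where y: "y \<in> carrier A" "adj A y = y" and "N \<ge> 0"
    and N: "nrm A (of_real N \<odot> \<one> \<ominus> y) \<le> N"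
    using assms(2) by (auto simp: order_unit_bounded_def cstar_sa_def)
  have "(a \<oplus> b) \<ominus> (x \<oplus> y) = (a \<ominus> x) \<oplus> (b \<ominus> y)" if "a \<in> carrier A" "b \<in> carrier A" for a b
    using that x y by algebra
  then have "of_real (M + N) \<odot> \<one> \<ominus> (x \<oplus> y) = (of_real M \<odot> \<one> \<ominus> x) \<oplus> (of_real N \<odot> \<one> \<ominus> y)"
    by (simp add: scale_simps)
  then have "nrm A (of_real (M + N) \<odot> \<one> \<ominus> (x \<oplus> y)) \<le> M + N"
    using nrm_triangle[of "of_real M \<odot> \<one> \<ominus> x" "of_real N \<odot> \<one> \<ominus> y"] M N x y by simp
  moreover have "0 \<le> M + N" using \<open>M \<ge> 0\<close> \<open>N \<ge> 0\<close> by simp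
  ultimately show ?thesis
    using x y unfolding order_unit_bounded_def cstar_sa_def by (auto simp: adj_add)
qed

lemma order_unit_bounded_scale:
  assumes "x \<in> order_unit_bounded" "0 \<le> c"
  shows "of_real c \<odot> x \<in> order_unit_bounded"
proof -
  obtain M where x: "x \<in> carrier A" "adj A x = x" and "M \<ge> 0"
    and M: "nrm A (of_real M \<odot> \<one> \<ominus> x) \<le> M"
    using assms(1) by (auto simp: order_unit_bounded_def cstar_sa_def)
  have "of_real (c * M) \<odot> \<one> \<ominus> of_real c \<odot> x = of_real c \<odot> (of_real M \<odot> \<one> \<ominus> x)"
    using x by (simp add: scale_minus scale_simps)
  then have "nrm A (of_real (c * M) \<odot> \<one> \<ominus> of_real c \<odot> x) \<le> c * M"
    using x M \<open>0 \<le> c\<close> by (simp add: nrm_smult mult_left_mono)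
  moreover have "0 \<le> c * M" using \<open>M \<ge> 0\<close> \<open>0 \<le> c\<close> by simp
  ultimately show ?thesis
    using x unfolding order_unit_bounded_def cstar_sa_def by (auto simp: adj_smult)
qed

lemma order_unit_bounded_finsum:
  assumes "finite I" "\<And>i. i \<in> I \<Longrightarrow> f i \<in> order_unit_bounded"
  shows "finsum A f I \<in> order_unit_bounded"
  using assms
proof (induction I)
  case empty
  have "\<zero> \<in> order_unit_bounded"
    unfolding order_unit_bounded_def cstar_sa_def by (auto simp: scale_simps a_minus_def intro!: exI[of _ 0])
  then show ?case by simp
next
  case (insert i I)
  then show ?case
    by (subst M.finsum_insert) (auto intro: order_unit_bounded_add order_unit_bounded_carrier)
qed

section \<open>Projections and their orthogonal sums\<close>

definition projections :: "'a set" where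
  "projections = {p \<in> carrier A. adj A p = p \<and> p \<otimes> p = p}"

lemma projections_carrier: "p \<in> projections \<Longrightarrow> p \<in> carrier A"
  by (simp add: projections_def)

lemma one_minus_projection: "p \<in> projections \<Longrightarrow> \<one> \<ominus> p \<in> projections"
proof -
  assume p: "p \<in> projections"
  then have c: "p \<in> carrier A" by (rule projections_carrier)
  then have "(\<one> \<ominus> p) \<otimes> (\<one> \<ominus> p) = \<one> \<ominus> p \<ominus> p \<oplus> p \<otimes> p"
    by (algebra, simp)
  also have "\<dots> = \<one> \<ominus> p \<ominus> p \<oplus> p"
    using p by (simp add: projections_def)
  also have "\<dots> = \<one> \<ominus> p"
    using c by algebra
  finally show ?thesis using p by (simp add: projections_def adj_minus)
qed

text \<open>For a projection the C*-identity becomes |p| = |p|^2, so the norm is 0 or 1.\<close>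

lemma nrm_projection_le_1: "p \<in> projections \<Longrightarrow> nrm A p \<le> 1"
  using cstar_identity[of p] by (auto simp: projections_def power2_eq_square)

text \<open>The bound M = 1 works because 1 - p is again a projection.\<close>

lemma projection_order_unit_bounded:
  assumes "p \<in> projections"
  shows "p \<in> order_unit_bounded"
  using assms nrm_projection_le_1[OF one_minus_projection[OF assms]]
  by (auto simp: order_unit_bounded_def cstar_sa_def projections_def scale_simps intro!: exI[of _ 1])

lemma adj_finsum:
  assumes "finite I" "\<And>i. i \<in> I \<Longrightarrow> f i \<in> carrier A"
  shows "adj A (finsum A f I) = finsum A (\<lambda>i. adj A (f i)) I"
  using assms
proof (induction I)
  case (insert i I)
  then show ?case
    by (subst (1 2) M.finsum_insert) (auto simp: adj_add adj_closed intro!: M.finsum_closed)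
qed simp

text \<open>In the double sum for the square only the diagonal terms p_i p_i = p_i survive.\<close>

lemma finsum_orthogonal_projections:
  assumes "finite I" "\<And>i. i \<in> I \<Longrightarrow> p i \<in> projections"
    and "\<And>i j. i \<in> I \<Longrightarrow> j \<in> I \<Longrightarrow> i \<noteq> j \<Longrightarrow> p i \<otimes> p j = \<zero>"
  shows "finsum A p I \<in> projections"
proof -
  have c: "p i \<in> carrier A" if "i \<in> I" for i
    using assms(2) that projections_carrier by blast
  have "finsum A p I \<otimes> finsum A p I = (\<Oplus>i\<in>I. p i \<otimes> finsum A p I)"
    using assms(1) c by (intro finsum_ldistr) auto
  also have "\<dots> = finsum A p I"
  proof (rule M.finsum_cong')
    fix i assume i: "i \<in> I"
    have "p i \<otimes> finsum A p I = (\<Oplus>j\<in>I. p i \<otimes> p j)"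
      using assms(1) c i by (intro finsum_rdistr) auto
    also have "\<dots> = (\<Oplus>j\<in>I. if i = j then p j else \<zero>)"
      using assms i c by (intro M.finsum_cong') (auto simp: projections_def)
    also have "\<dots> = p i"
      using assms(1) i c by (intro M.finsum_singleton) auto
    finally show "p i \<otimes> finsum A p I = p i" .
  qed (use c in auto)
  moreover have "adj A (finsum A p I) = finsum A p I"
    using assms(1,2) c by (simp add: adj_finsum) (rule M.finsum_cong', auto simp: projections_def)
  moreover have "finsum A p I \<in> carrier A"
    using c by (intro M.finsum_closed) auto
  ultimately show ?thesis by (simp add: projections_def)
qed

section \<open>Rearranging finite sums\<close>

lemma finsum_swap:
  assumes "finite I" "finite J" "\<And>i j. i \<in> I \<Longrightarrow> j \<in> J \<Longrightarrow> f i j \<in> carrier A"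
  shows "(\<Oplus>i\<in>I. \<Oplus>j\<in>J. f i j) = (\<Oplus>j\<in>J. \<Oplus>i\<in>I. f i j)"
  using assms(1,3)
proof (induction I)
  case (insert i I)
  then have "(\<Oplus>j\<in>J. \<Oplus>i\<in>insert i I. f i j) = (\<Oplus>j\<in>J. f i j \<oplus> (\<Oplus>i\<in>I. f i j))"
    by (intro M.finsum_cong') (auto intro!: M.finsum_insert M.finsum_closed M.add.m_closed)
  also have "\<dots> = (\<Oplus>j\<in>J. f i j) \<oplus> (\<Oplus>j\<in>J. \<Oplus>i\<in>I. f i j)"
    using insert.prems by (intro M.finsum_addf) (auto intro!: M.finsum_closed)
  also have "\<dots> = (\<Oplus>i\<in>insert i I. \<Oplus>j\<in>J. f i j)"
    using insert by (subst M.finsum_insert) (auto intro!: M.finsum_closed)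
  finally show ?case by simp
qed simp

text \<open>Two applications turn a sum in the order k, l, i, j into one in the order i, j, k,
  l.\<close>

lemma finsum_rotate:
  assumes "finite I" "finite J" "finite K"
    and "\<And>i j k. i \<in> I \<Longrightarrow> j \<in> J \<Longrightarrow> k \<in> K \<Longrightarrow> f i j k \<in> carrier A"
  shows "(\<Oplus>i\<in>I. \<Oplus>j\<in>J. \<Oplus>k\<in>K. f i j k) = (\<Oplus>k\<in>K. \<Oplus>i\<in>I. \<Oplus>j\<in>J. f i j k)"
proof -
  have "(\<Oplus>i\<in>I. \<Oplus>j\<in>J. \<Oplus>k\<in>K. f i j k) = (\<Oplus>i\<in>I. \<Oplus>k\<in>K. \<Oplus>j\<in>J. f i j k)"
    using assms by (intro M.finsum_cong' finsum_swap) (auto intro!: M.finsum_closed)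
  also have "\<dots> = (\<Oplus>k\<in>K. \<Oplus>i\<in>I. \<Oplus>j\<in>J. f i j k)"
    using assms by (intro finsum_swap) (auto intro!: M.finsum_closed)
  finally show ?thesis .
qed

lemma finsum_mult:
  assumes "finite I" "finite J" "\<And>i. i \<in> I \<Longrightarrow> f i \<in> carrier A" "\<And>j. j \<in> J \<Longrightarrow> g j \<in> carrier A"
  shows "finsum A f I \<otimes> finsum A g J = (\<Oplus>i\<in>I. \<Oplus>j\<in>J. f i \<otimes> g j)"
proof -
  have "finsum A f I \<otimes> finsum A g J = (\<Oplus>i\<in>I. f i \<otimes> finsum A g J)"
    using assms by (intro finsum_ldistr) (auto intro!: M.finsum_closed)
  also have "\<dots> = (\<Oplus>i\<in>I. \<Oplus>j\<in>J. f i \<otimes> g j)"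
    using assms by (intro M.finsum_cong' finsum_rdistr) (auto intro!: M.finsum_closed)
  finally show ?thesis .
qed

lemma finsum_minus:
  assumes "finite I" "\<And>i. i \<in> I \<Longrightarrow> f i \<in> carrier A" "\<And>i. i \<in> I \<Longrightarrow> g i \<in> carrier A"
  shows "(\<Oplus>i\<in>I. f i \<ominus> g i) = finsum A f I \<ominus> finsum A g I"
proof -
  have "(\<Oplus>i\<in>I. f i \<ominus> g i) = finsum A f I \<oplus> (\<Oplus>i\<in>I. \<ominus> g i)"
    unfolding a_minus_def using assms by (intro M.finsum_addf) auto
  also have "(\<Oplus>i\<in>I. \<ominus> g i) = (\<Oplus>i\<in>I. (- 1) \<odot> g i)"
    using assms by (intro M.finsum_cong') (auto simp: scale_simps)
  also have "\<dots> = (- 1) \<odot> finsum A g I"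
    using assms by (intro finsum_smult_ldistr[symmetric]) auto
  also have "\<dots> = \<ominus> finsum A g I"
    using assms by (auto simp: scale_simps Pi_def)
  finally show ?thesis by (simp add: a_minus_def)
qed

lemma finsum_const_scale:
  assumes "finite I" "x \<in> carrier A"
  shows "(\<Oplus>i\<in>I. x) = of_nat (card I) \<odot> x"
  using assms by (induction I) (simp_all add: scale_simps)

end

section \<open>Square-summable families, and orthogonality from a faithful representation\<close>

text \<open>Absolute summability follows by comparison, from 2 |a| |b| \<le> |a|^2 + |b|^2.\<close>

lemma ell2_mult_summable:
  assumes "x \<in> ell2" "y \<in> ell2"
  shows "(\<lambda>i. cnj (x i) * y i) summable_on UNIV"
proof -
  have "(\<lambda>i. (cmod (x i))\<^sup>2 + (cmod (y i))\<^sup>2) summable_on UNIV"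
    using assms by (intro summable_on_add) (auto simp: ell2_def)
  then have "(\<lambda>i. cnj (x i) * y i) abs_summable_on UNIV"
  proof (rule summable_on_comparison_test)
    fix i
    have "2 * (cmod (x i) * cmod (y i)) \<le> (cmod (x i))\<^sup>2 + (cmod (y i))\<^sup>2"
      using sum_squares_bound[of "cmod (x i)" "cmod (y i)"] by simp
    moreover have "0 \<le> cmod (x i) * cmod (y i)" by simp
    ultimately show "norm (cnj (x i) * y i) \<le> (cmod (x i))\<^sup>2 + (cmod (y i))\<^sup>2"
      unfolding norm_mult complex_mod_cnj by linarith
  qed simp
  then show ?thesis by (rule abs_summable_summable)
qed

lemma ell2_inner_add_right:
  assumes "x \<in> ell2" "y \<in> ell2" "z \<in> ell2"
  shows "ell2_inner x (\<lambda>i. y i + z i) = ell2_inner x y + ell2_inner x z"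
  unfolding ell2_inner_def distrib_left
  using assms by (intro infsum_add ell2_mult_summable)

lemma ell2_inner_self:
  assumes "x \<in> ell2"
  shows "ell2_inner x x = of_real ((ell2_norm x)\<^sup>2)"
proof -
  have "ell2_inner x x = (\<Sum>\<^sub>\<infinity>i. complex_of_real ((cmod (x i))\<^sup>2))"
    unfolding ell2_inner_def by (simp add: mult.commute flip: complex_norm_square)
  also have "\<dots> = of_real (\<Sum>\<^sub>\<infinity>i. (cmod (x i))\<^sup>2)"
    using assms by (intro infsumI has_sum_of_real has_sum_infsum) (simp add: ell2_def)
  also have "(\<Sum>\<^sub>\<infinity>i. (cmod (x i))\<^sup>2) = (ell2_norm x)\<^sup>2"
    unfolding ell2_norm_def by (simp add: infsum_nonneg)
  finally show ?thesis .
qed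

context unital_cstar_algebra
begin

text \<open>The functional sending a to the inner product of v with \<open>\<pi> a v\<close> maps
  x_i* x_i to the squared norm of \<open>\<pi> (x i) v\<close>. A vanishing sum of nonnegative reals
  has vanishing terms, so \<open>\<pi> (x j)\<close> is zero on every v, and x_j = 0 because the
  representation is isometric.\<close>

lemma finsum_adj_mult_eq_zeroD:
  assumes rep: "faithful_rep A \<pi>" and fin: "finite I" and x: "\<And>i. i \<in> I \<Longrightarrow> x i \<in> carrier A"
    and zero: "(\<Oplus>i\<in>I. adj A (x i) \<otimes> x i) = \<zero>" and j: "j \<in> I"
  shows "x j = \<zero>"
proof -
  have ell2: "\<pi> a v \<in> ell2" if "a \<in> carrier A" "v \<in> ell2" for a v
    using rep that by (auto simp: faithful_rep_def ell2_bounded_op_def)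
  have "ell2_norm (\<pi> (x j) v) = 0" if v: "v \<in> ell2" for v
  proof -
    define f where "f a = ell2_inner v (\<pi> a v)" for a
    have f_add: "f (a \<oplus> b) = f a + f b" if "a \<in> carrier A" "b \<in> carrier A" for a b
      using rep that v ell2_inner_add_right[OF v ell2[OF that(1) v] ell2[OF that(2) v]]
      by (simp add: f_def faithful_rep_def)
    have f_zero: "f \<zero> = 0"
      using f_add[of \<zero> \<zero>] by simp
    have f_adj: "f (adj A a \<otimes> a) = of_real ((ell2_norm (\<pi> a v))\<^sup>2)" if a: "a \<in> carrier A" for a
    proof -
      have "f (adj A a \<otimes> a) = ell2_inner v (\<pi> (adj A a) (\<pi> a v))"
        using rep a v adj_closed[OF a] by (simp add: f_def faithful_rep_def)
      also have "\<dots> = ell2_inner (\<pi> (adj A (adj A a)) v) (\<pi> a v)"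
        using rep adj_closed[OF a] v ell2[OF a v] unfolding faithful_rep_def by simp
      also have "\<dots> = of_real ((ell2_norm (\<pi> a v))\<^sup>2)"
        using a v by (simp add: adj_adj ell2_inner_self ell2)
      finally show ?thesis .
    qed
    have "f (finsum A g I) = (\<Sum>i\<in>I. f (g i))" if "\<And>i. i \<in> I \<Longrightarrow> g i \<in> carrier A" for g
      using fin that
    proof (induction I)
      case (insert i J)
      then show ?case
        by (subst M.finsum_insert) (auto simp: f_add intro!: M.finsum_closed)
    qed (simp add: f_zero)
    from this[of "\<lambda>i. adj A (x i) \<otimes> x i"]
    have "of_real (\<Sum>i\<in>I. (ell2_norm (\<pi> (x i) v))\<^sup>2) = (0 :: complex)"
      using x by (simp add: zero f_zero f_adj adj_closed)
    then have "(\<Sum>i\<in>I. (ell2_norm (\<pi> (x i) v))\<^sup>2) = 0"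
      by (simp only: of_real_eq_0_iff)
    then show ?thesis
      using fin j by (simp add: sum_nonneg_eq_0_iff)
  qed
  then have "ell2_op_norm (\<pi> (x j)) = (SUP v \<in> {v \<in> ell2 :: ('b \<Rightarrow> complex) set. ell2_norm v \<le> 1}. 0)"
    unfolding ell2_op_norm_def by (intro SUP_cong) auto
  also have "\<dots> = 0"
  proof (rule cSUP_const)
    \<comment> \<open>The supremum of a constant real family is that constant only over a nonempty
      set; the zero vector lies in the unit ball.\<close>
    have "(\<lambda>_. 0) \<in> {v \<in> ell2 :: ('b \<Rightarrow> complex) set. ell2_norm v \<le> 1}"
      by (simp add: ell2_def ell2_norm_def)
    then show "{v \<in> ell2 :: ('b \<Rightarrow> complex) set. ell2_norm v \<le> 1} \<noteq> {}" by blast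
  qed
  finally show ?thesis
    using rep x[OF j] by (simp add: faithful_rep_def nrm_eq_0_iff)
qed

text \<open>Sandwiching 1 - p_j, the sum of the other projections, between two copies of p_j gives
  0. Since p_k = p_k p_k, each resulting term p_j p_k p_j is x* x for x = p_k p_j, so all these x
  vanish.\<close>

lemma partition_of_unity_orthogonal:
  assumes rep: "faithful_rep A \<pi>" and fin: "finite I" and p: "\<And>i. i \<in> I \<Longrightarrow> p i \<in> projections"
    and one: "finsum A p I = \<one>" and i: "i \<in> I" and j: "j \<in> I" and "i \<noteq> j"
  shows "p i \<otimes> p j = \<zero>"
proof -
  have c [simp]: "p i \<in> carrier A" if "i \<in> I" for i
    using p that projections_carrier by blast
  have idem: "p i \<otimes> p i = p i" if "i \<in> I" for i
    using p[OF that] by (simp add: projections_def)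
  define q where "q = finsum A p (I - {j})"
  have q: "q \<in> carrier A" unfolding q_def by (intro M.finsum_closed) auto
  have "\<one> = p j \<oplus> q"
    using M.finsum_insert[of "I - {j}" j p] fin j one by (simp add: q_def insert_absorb Pi_def)
  moreover have "p j \<oplus> q \<ominus> p j = q"
    using q c[OF j] by algebra
  ultimately have "p j \<otimes> q = p j \<otimes> (\<one> \<ominus> p j)"
    by simp
  also have "\<dots> = p j \<ominus> p j \<otimes> p j"
    using c[OF j] by (algebra, simp)
  also have "\<dots> = \<zero>"
    using j by (simp add: idem a_minus_def M.r_neg)
  finally have "p j \<otimes> q \<otimes> p j = \<zero>" using j by simp
  moreover have "p j \<otimes> q \<otimes> p j = (\<Oplus>k\<in>I - {j}. p j \<otimes> p k) \<otimes> p j"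
    unfolding q_def using fin j by (subst finsum_rdistr) auto
  moreover have "\<dots> = (\<Oplus>k\<in>I - {j}. p j \<otimes> p k \<otimes> p j)"
    using fin j by (intro finsum_ldistr) auto
  moreover have "\<dots> = (\<Oplus>k\<in>I - {j}. adj A (p k \<otimes> p j) \<otimes> (p k \<otimes> p j))"
  proof (rule M.finsum_cong')
    fix k assume k: "k \<in> I - {j}"
    have "adj A (p k \<otimes> p j) \<otimes> (p k \<otimes> p j) = p j \<otimes> p k \<otimes> (p k \<otimes> p j)"
      using k j p by (simp add: adj_mult projections_def)
    also have "\<dots> = p j \<otimes> (p k \<otimes> p k) \<otimes> p j"
      using k j by (simp add: m_assoc)
    finally show "p j \<otimes> p k \<otimes> p j = adj A (p k \<otimes> p j) \<otimes> (p k \<otimes> p j)"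
      using k by (simp add: idem)
  qed (use j in \<open>auto simp: adj_closed\<close>)
  ultimately have "(\<Oplus>k\<in>I - {j}. adj A (p k \<otimes> p j) \<otimes> (p k \<otimes> p j)) = \<zero>" by simp
  then show ?thesis
    using fin i j \<open>i \<noteq> j\<close> by (intro finsum_adj_mult_eq_zeroD[OF rep, of "I - {j}" "\<lambda>k. p k \<otimes> p j"]) auto
qed

end

section \<open>Additive maps, tensor products and *-homomorphisms\<close>

text \<open>Only additivity is assumed, so that the statement covers *-homomorphisms as well as a
  tensor product with one argument fixed. The empty sum is handled by cancelling in \<phi>(0) =
  \<phi>(0) + \<phi>(0).\<close>

lemma additive_finsum:
  assumes "abelian_group A" "abelian_group B" "finite I"
    and f: "\<And>i. i \<in> I \<Longrightarrow> f i \<in> carrier A"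
    and closed: "\<And>x. x \<in> carrier A \<Longrightarrow> \<phi> x \<in> carrier B"
    and add: "\<And>x y. x \<in> carrier A \<Longrightarrow> y \<in> carrier A \<Longrightarrow> \<phi> (x \<oplus>\<^bsub>A\<^esub> y) = \<phi> x \<oplus>\<^bsub>B\<^esub> \<phi> y"
  shows "\<phi> (finsum A f I) = finsum B (\<lambda>i. \<phi> (f i)) I"
proof -
  interpret A: abelian_group A by fact
  interpret B: abelian_group B by fact
  have zero: "\<phi> \<zero>\<^bsub>A\<^esub> = \<zero>\<^bsub>B\<^esub>"
    using add[of "\<zero>\<^bsub>A\<^esub>" "\<zero>\<^bsub>A\<^esub>"] closed[of "\<zero>\<^bsub>A\<^esub>"] by simp
  show ?thesis
    using \<open>finite I\<close> f
  proof (induction I)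
    case (insert i I)
    then show ?case
      by (subst A.finsum_insert, simp_all add: Pi_def, subst B.finsum_insert)
        (auto simp: add closed intro!: A.finsum_closed)
  qed (simp add: zero)
qed

lemma additive_minus:
  assumes "abelian_group A" "abelian_group B"
    and closed: "\<And>x. x \<in> carrier A \<Longrightarrow> \<phi> x \<in> carrier B"
    and add: "\<And>x y. x \<in> carrier A \<Longrightarrow> y \<in> carrier A \<Longrightarrow> \<phi> (x \<oplus>\<^bsub>A\<^esub> y) = \<phi> x \<oplus>\<^bsub>B\<^esub> \<phi> y"
    and x: "x \<in> carrier A" and y: "y \<in> carrier A"
  shows "\<phi> (x \<ominus>\<^bsub>A\<^esub> y) = \<phi> x \<ominus>\<^bsub>B\<^esub> \<phi> y"
proof -
  interpret A: abelian_group A by fact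
  interpret B: abelian_group B by fact
  have "\<phi> x = \<phi> ((x \<ominus>\<^bsub>A\<^esub> y) \<oplus>\<^bsub>A\<^esub> y)"
    using x y by (simp add: a_minus_def A.a_assoc A.l_neg)
  also have "\<dots> = \<phi> (x \<ominus>\<^bsub>A\<^esub> y) \<oplus>\<^bsub>B\<^esub> \<phi> y"
    using x y by (intro add) auto
  finally show ?thesis
    using x y closed[of "x \<ominus>\<^bsub>A\<^esub> y"] closed[of y] by (simp add: a_minus_def B.a_assoc B.r_neg)
qed

text \<open>Collects the algebraic identities of \<open>is_min_tensor\<close>, to be instantiated
  twice: for the product of \<open>A\<close> with itself and for that of \<open>A2\<close> with
  itself.\<close>

locale cstar_tensor =
  A: unital_cstar_algebra A + B: unital_cstar_algebra B + T: unital_cstar_algebra T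
  for A :: "'a cstar" and B :: "'b cstar" and T :: "'c cstar" +
  fixes t :: "'a \<Rightarrow> 'b \<Rightarrow> 'c"
  assumes closed: "a \<in> carrier A \<Longrightarrow> b \<in> carrier B \<Longrightarrow> t a b \<in> carrier T"
    and add_left: "a \<in> carrier A \<Longrightarrow> a' \<in> carrier A \<Longrightarrow> b \<in> carrier B \<Longrightarrow>
      t (a \<oplus>\<^bsub>A\<^esub> a') b = t a b \<oplus>\<^bsub>T\<^esub> t a' b"
    and add_right: "a \<in> carrier A \<Longrightarrow> b \<in> carrier B \<Longrightarrow> b' \<in> carrier B \<Longrightarrow>
      t a (b \<oplus>\<^bsub>B\<^esub> b') = t a b \<oplus>\<^bsub>T\<^esub> t a b'"
    and mult: "a \<in> carrier A \<Longrightarrow> a' \<in> carrier A \<Longrightarrow> b \<in> carrier B \<Longrightarrow> b' \<in> carrier B \<Longrightarrow>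
      t (a \<otimes>\<^bsub>A\<^esub> a') (b \<otimes>\<^bsub>B\<^esub> b') = t a b \<otimes>\<^bsub>T\<^esub> t a' b'"
    and adj: "a \<in> carrier A \<Longrightarrow> b \<in> carrier B \<Longrightarrow> t (adj A a) (adj B b) = adj T (t a b)"
    and one: "t \<one>\<^bsub>A\<^esub> \<one>\<^bsub>B\<^esub> = \<one>\<^bsub>T\<^esub>"
begin

lemma zero_left: "b \<in> carrier B \<Longrightarrow> t \<zero>\<^bsub>A\<^esub> b = \<zero>\<^bsub>T\<^esub>"
  using add_left[of "\<zero>\<^bsub>A\<^esub>" "\<zero>\<^bsub>A\<^esub>" b] closed[of "\<zero>\<^bsub>A\<^esub>" b] by simp

lemma finsum_left:
  assumes "finite I" "\<And>i. i \<in> I \<Longrightarrow> f i \<in> carrier A" "b \<in> carrier B"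
  shows "t (finsum A f I) b = (\<Oplus>\<^bsub>T\<^esub>i\<in>I. t (f i) b)"
  using assms
  by (intro additive_finsum[of A T _ _ "\<lambda>a. t a b"] A.M.abelian_group_axioms T.M.abelian_group_axioms)
    (auto simp: add_left closed)

lemma finsum_right:
  assumes "finite I" "\<And>i. i \<in> I \<Longrightarrow> f i \<in> carrier B" "a \<in> carrier A"
  shows "t a (finsum B f I) = (\<Oplus>\<^bsub>T\<^esub>i\<in>I. t a (f i))"
  using assms
  by (intro additive_finsum[of B T _ _ "t a"] B.M.abelian_group_axioms T.M.abelian_group_axioms)
    (auto simp: add_right closed)

lemma finsum_both:
  assumes "finite I" "finite J" "\<And>i. i \<in> I \<Longrightarrow> f i \<in> carrier A" "\<And>j. j \<in> J \<Longrightarrow> g j \<in> carrier B"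
  shows "t (finsum A f I) (finsum B g J) = (\<Oplus>\<^bsub>T\<^esub>i\<in>I. \<Oplus>\<^bsub>T\<^esub>j\<in>J. t (f i) (g j))"
proof -
  have "t (finsum A f I) (finsum B g J) = (\<Oplus>\<^bsub>T\<^esub>i\<in>I. t (f i) (finsum B g J))"
    using assms by (intro finsum_left) (auto intro!: B.M.finsum_closed)
  also have "\<dots> = (\<Oplus>\<^bsub>T\<^esub>i\<in>I. \<Oplus>\<^bsub>T\<^esub>j\<in>J. t (f i) (g j))"
    using assms by (intro T.M.finsum_cong' finsum_right) (auto intro!: T.M.finsum_closed closed)
  finally show ?thesis .
qed

lemma minus_left:
  assumes "a \<in> carrier A" "a' \<in> carrier A" "b \<in> carrier B"
  shows "t (a \<ominus>\<^bsub>A\<^esub> a') b = t a b \<ominus>\<^bsub>T\<^esub> t a' b"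
  using assms
  by (intro additive_minus[of A T "\<lambda>a. t a b"] A.M.abelian_group_axioms T.M.abelian_group_axioms)
    (auto simp: add_left closed)

lemma minus_right:
  assumes "a \<in> carrier A" "b \<in> carrier B" "b' \<in> carrier B"
  shows "t a (b \<ominus>\<^bsub>B\<^esub> b') = t a b \<ominus>\<^bsub>T\<^esub> t a b'"
  using assms
  by (intro additive_minus[of B T "t a"] B.M.abelian_group_axioms T.M.abelian_group_axioms)
    (auto simp: add_right closed)

lemma tensor_projection:
  assumes "p \<in> A.projections" "q \<in> B.projections"
  shows "t p q \<in> T.projections"
  using assms adj[of p q] mult[of p p q q]
  by (simp add: A.projections_def B.projections_def T.projections_def closed)

text \<open>Orthogonality in the left factor already kills the mixed products, so the q_i may be
  arbitrary projections. This is what allows different indices in the two factors of E_kl and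
  F_kl.\<close>

lemma tensor_sum_projection:
  assumes "finite I" "\<And>i. i \<in> I \<Longrightarrow> p i \<in> A.projections" "\<And>i. i \<in> I \<Longrightarrow> q i \<in> B.projections"
    and orth: "\<And>i j. i \<in> I \<Longrightarrow> j \<in> I \<Longrightarrow> i \<noteq> j \<Longrightarrow> p i \<otimes>\<^bsub>A\<^esub> p j = \<zero>\<^bsub>A\<^esub>"
  shows "(\<Oplus>\<^bsub>T\<^esub>i\<in>I. t (p i) (q i)) \<in> T.projections"
proof (rule T.finsum_orthogonal_projections)
  fix i j assume ij: "i \<in> I" "j \<in> I" "i \<noteq> j"
  have "t (p i) (q i) \<otimes>\<^bsub>T\<^esub> t (p j) (q j) = t (p i \<otimes>\<^bsub>A\<^esub> p j) (q i \<otimes>\<^bsub>B\<^esub> q j)"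
    using ij assms(2,3) by (intro mult[symmetric] A.projections_carrier B.projections_carrier)
  also have "\<dots> = \<zero>\<^bsub>T\<^esub>"
    using ij assms(3)[of i] assms(3)[of j] orth by (simp add: zero_left B.projections_carrier)
  finally show "t (p i) (q i) \<otimes>\<^bsub>T\<^esub> t (p j) (q j) = \<zero>\<^bsub>T\<^esub>" .
qed (use assms in \<open>auto intro: tensor_projection\<close>)

text \<open>The bracketing sets e \<otimes> f apart as last summand, where the diagonal term
  \<open>W k k\<close> appears in \<open>H k\<close>.\<close>

lemma tensor_complements:
  assumes "e \<in> carrier A" "f \<in> carrier B"
  shows "t (\<one>\<^bsub>A\<^esub> \<ominus>\<^bsub>A\<^esub> e) (\<one>\<^bsub>B\<^esub> \<ominus>\<^bsub>B\<^esub> f)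
    = (\<one>\<^bsub>T\<^esub> \<ominus>\<^bsub>T\<^esub> t e \<one>\<^bsub>B\<^esub> \<ominus>\<^bsub>T\<^esub> t \<one>\<^bsub>A\<^esub> f) \<oplus>\<^bsub>T\<^esub> t e f"
proof -
  have "t (\<one>\<^bsub>A\<^esub> \<ominus>\<^bsub>A\<^esub> e) (\<one>\<^bsub>B\<^esub> \<ominus>\<^bsub>B\<^esub> f)
    = (\<one>\<^bsub>T\<^esub> \<ominus>\<^bsub>T\<^esub> t e \<one>\<^bsub>B\<^esub>) \<ominus>\<^bsub>T\<^esub> (t \<one>\<^bsub>A\<^esub> f \<ominus>\<^bsub>T\<^esub> t e f)"
    using assms by (simp add: minus_left minus_right one)
  moreover have "a \<ominus>\<^bsub>T\<^esub> b \<ominus>\<^bsub>T\<^esub> (c \<ominus>\<^bsub>T\<^esub> d) = (a \<ominus>\<^bsub>T\<^esub> b \<ominus>\<^bsub>T\<^esub> c) \<oplus>\<^bsub>T\<^esub> d"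
    if "a \<in> carrier T" "b \<in> carrier T" "c \<in> carrier T" "d \<in> carrier T" for a b c d
    using that by algebra
  ultimately show ?thesis
    using assms by (simp add: closed)
qed

end

lemma is_min_tensor_cstar_tensor:
  assumes "unital_cstar_algebra A" "unital_cstar_algebra B" "is_min_tensor A B T t"
  shows "cstar_tensor A B T t"
  using assms by (simp add: is_min_tensor_def cstar_tensor_def cstar_tensor_axioms_def)

locale cstar_hom = A: unital_cstar_algebra A + B: unital_cstar_algebra B
  for A :: "'a cstar" and B :: "'b cstar" +
  fixes \<phi> :: "'a \<Rightarrow> 'b"
  assumes hom: "unital_star_hom A B \<phi>"
begin

lemma closed: "x \<in> carrier A \<Longrightarrow> \<phi> x \<in> carrier B"
  using hom by (auto simp: unital_star_hom_def ring_hom_def)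

lemma add: "x \<in> carrier A \<Longrightarrow> y \<in> carrier A \<Longrightarrow> \<phi> (x \<oplus>\<^bsub>A\<^esub> y) = \<phi> x \<oplus>\<^bsub>B\<^esub> \<phi> y"
  using hom by (auto simp: unital_star_hom_def ring_hom_def)

lemma mult: "x \<in> carrier A \<Longrightarrow> y \<in> carrier A \<Longrightarrow> \<phi> (x \<otimes>\<^bsub>A\<^esub> y) = \<phi> x \<otimes>\<^bsub>B\<^esub> \<phi> y"
  using hom by (auto simp: unital_star_hom_def ring_hom_def)

lemma one: "\<phi> \<one>\<^bsub>A\<^esub> = \<one>\<^bsub>B\<^esub>"
  using hom by (auto simp: unital_star_hom_def ring_hom_def)

lemma scale: "x \<in> carrier A \<Longrightarrow> \<phi> (c \<odot>\<^bsub>A\<^esub> x) = c \<odot>\<^bsub>B\<^esub> \<phi> x"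
  using hom by (auto simp: unital_star_hom_def)

lemma finsum:
  assumes "finite I" "\<And>i. i \<in> I \<Longrightarrow> f i \<in> carrier A"
  shows "\<phi> (finsum A f I) = (\<Oplus>\<^bsub>B\<^esub>i\<in>I. \<phi> (f i))"
  using assms
  by (intro additive_finsum A.M.abelian_group_axioms B.M.abelian_group_axioms)
    (auto simp: add closed)

lemma minus:
  assumes "x \<in> carrier A" "y \<in> carrier A"
  shows "\<phi> (x \<ominus>\<^bsub>A\<^esub> y) = \<phi> x \<ominus>\<^bsub>B\<^esub> \<phi> y"
  using assms
  by (intro additive_minus A.M.abelian_group_axioms B.M.abelian_group_axioms) (auto simp: add closed)

lemma adj: "x \<in> carrier A \<Longrightarrow> \<phi> (adj A x) = adj B (\<phi> x)"
  using hom by (simp add: unital_star_hom_def)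

lemma sa:
  assumes "x \<in> cstar_sa A"
  shows "\<phi> x \<in> cstar_sa B"
  using assms adj[of x] by (simp add: cstar_sa_def closed)

end

section \<open>Magic unitaries and the inequality for C_H\<close>

lemma magic_unitary_projection:
  assumes "unital_cstar_algebra A" "magic_unitary n A u" "i \<in> {1..n}" "j \<in> {1..n}"
  shows "u i j \<in> unital_cstar_algebra.projections A"
proof -
  interpret unital_cstar_algebra A by fact
  show ?thesis using assms(2-) by (simp add: magic_unitary_def projections_def)
qed

theorem lemma4p18:
  fixes n :: nat
    and A :: "'a cstar" and u :: "nat \<Rightarrow> nat \<Rightarrow> 'a"
    and A2 :: "'c cstar" and t :: "'a \<Rightarrow> 'a \<Rightarrow> 'c"
    and A4 :: "'d cstar" and s :: "'c \<Rightarrow> 'c \<Rightarrow> 'd"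
    and \<Delta> :: "'a \<Rightarrow> 'c" and \<iota> :: "nat \<Rightarrow> nat \<Rightarrow> 'c \<Rightarrow> 'd" and \<Delta>t :: "'c \<Rightarrow> 'd"
  assumes "n \<ge> 1"
    and "is_C_Sn_plus n A u"
    and "is_min_tensor A A A2 t"
    and "is_min_tensor A2 A2 A4 s"
    and "is_comultiplication n A u A2 t \<Delta>"
    and "are_leg_embeddings A A2 t A4 s \<iota>"
    and "is_Delta_tilde A A2 t A4 \<Delta> \<iota> \<Delta>t"
  shows "C_H n u A2 t \<in> cstar_pos A2 \<and>
    cstar_le A4 (\<Delta>t (C_H n u A2 t)) (\<iota> 1 2 (C_H n u A2 t) \<oplus>\<^bsub>A4\<^esub> \<iota> 3 4 (C_H n u A2 t))"
proof -
  have algA: "unital_cstar_algebra A" and magic: "magic_unitary n A u"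
    using assms(2) by (auto simp: is_C_Sn_plus_def)
  have algA2: "unital_cstar_algebra A2" and algA4: "unital_cstar_algebra A4"
    using assms(3,4) by (auto simp: is_min_tensor_def)
  \<comment> \<open>A faithful representation of \<open>A\<close> is part of the data of the minimal
    tensor product.\<close>
  obtain \<pi> :: "'a \<Rightarrow> ('a \<Rightarrow> complex) \<Rightarrow> ('a \<Rightarrow> complex)" where rep: "faithful_rep A \<pi>"
    using assms(3) unfolding is_min_tensor_def by (elim conjE exE) (rule that)
  interpret A: unital_cstar_algebra A by fact
  interpret A2: unital_cstar_algebra A2 by fact
  interpret A4: unital_cstar_algebra A4 by fact
  interpret t: cstar_tensor A A A2 t
    using algA algA assms(3) by (rule is_min_tensor_cstar_tensor)
  interpret s: cstar_tensor A2 A2 A4 s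
    using algA2 algA2 assms(4) by (rule is_min_tensor_cstar_tensor)
  interpret \<Delta>: cstar_hom A A2 \<Delta>
    using assms(5) by unfold_locales (simp add: is_comultiplication_def)
  interpret \<Delta>t: cstar_hom A2 A4 \<Delta>t
    using assms(7) by unfold_locales (simp add: is_Delta_tilde_def)
  have leg: "cstar_hom A2 A4 (\<iota> i j)" if "i \<in> {1..4}" "j \<in> {1..4}" "i \<noteq> j" for i j
    using assms(6) that by unfold_locales (simp add: are_leg_embeddings_def)
  interpret \<iota>12: cstar_hom A2 A4 "\<iota> 1 2" by (rule leg) auto
  interpret \<iota>34: cstar_hom A2 A4 "\<iota> 3 4" by (rule leg) auto
  interpret \<iota>13: cstar_hom A2 A4 "\<iota> 1 3" by (rule leg) auto
  interpret \<iota>24: cstar_hom A2 A4 "\<iota> 2 4" by (rule leg) auto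

  define I where "I = {1..n}"
  have fin [simp]: "finite I" and card [simp]: "card I = n"
    by (simp_all add: I_def)
  define c where "c = complex_of_real (1 / real n)"
  \<comment> \<open>This is where \<open>n \<ge> 1\<close> enters: for n = 0 the convention 1 / 0 =
    0 would make the product 0.\<close>
  have c_nat: "c * of_nat n = 1" using \<open>n \<ge> 1\<close> by (simp add: c_def)
  have u_proj: "u i j \<in> A.projections" if "i \<in> I" "j \<in> I" for i j
    using algA magic that unfolding I_def by (rule magic_unitary_projection)
  then have u [simp]: "u i j \<in> carrier A" if "i \<in> I" "j \<in> I" for i j
    using that A.projections_carrier by blast
  have column_orth: "u i k \<otimes>\<^bsub>A\<^esub> u j k = \<zero>\<^bsub>A\<^esub>" if "i \<in> I" "j \<in> I" "i \<noteq> j" "k \<in> I" for i j k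
    using that magic u_proj
    by (intro A.partition_of_unity_orthogonal[OF rep, of I "\<lambda>i. u i k"]) (auto simp: magic_unitary_def I_def)
  have row_orth: "u k i \<otimes>\<^bsub>A\<^esub> u k j = \<zero>\<^bsub>A\<^esub>" if "i \<in> I" "j \<in> I" "i \<noteq> j" "k \<in> I" for i j k
    using that magic u_proj
    by (intro A.partition_of_unity_orthogonal[OF rep, of I "\<lambda>i. u k i"]) (auto simp: magic_unitary_def I_def)
  define E where "E k l = (\<Oplus>\<^bsub>A2\<^esub>i\<in>I. t (u i k) (u i l))" for k l
  define F where "F k l = (\<Oplus>\<^bsub>A2\<^esub>j\<in>I. t (u k j) (u l j))" for k l
  have E_proj: "E k l \<in> A2.projections" if "k \<in> I" "l \<in> I" for k l
    unfolding E_def using that u_proj column_orth by (intro t.tensor_sum_projection) auto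
  have F_proj: "F k l \<in> A2.projections" if "k \<in> I" "l \<in> I" for k l
    unfolding F_def using that u_proj row_orth by (intro t.tensor_sum_projection) auto
  note E [simp] = A2.projections_carrier[OF E_proj]
  note F [simp] = A2.projections_carrier[OF F_proj]
  have tu [simp]: "t (u i j) (u k l) \<in> carrier A2"
    if "i \<in> I" "j \<in> I" "k \<in> I" "l \<in> I" for i j k l
    using that by (intro t.closed) auto

  let ?C = "C_H n u A2 t"
  have C_F: "?C = \<one>\<^bsub>A2\<^esub> \<ominus>\<^bsub>A2\<^esub> c \<odot>\<^bsub>A2\<^esub> (\<Oplus>\<^bsub>A2\<^esub>k\<in>I. F k k)"
    by (simp add: C_H_def c_def F_def I_def)
  \<comment> \<open>Summing rows first or columns first gives the same element. The column form is
    used for legs 1, 2 and the row form for legs 3, 4 and for \<open>\<Delta>t\<close>.\<close>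
  have "(\<Oplus>\<^bsub>A2\<^esub>k\<in>I. F k k) = (\<Oplus>\<^bsub>A2\<^esub>k\<in>I. E k k)"
    unfolding E_def F_def by (rule A2.finsum_swap) auto
  then have C_E: "?C = \<one>\<^bsub>A2\<^esub> \<ominus>\<^bsub>A2\<^esub> c \<odot>\<^bsub>A2\<^esub> (\<Oplus>\<^bsub>A2\<^esub>k\<in>I. E k k)"
    by (simp add: C_F)
  have "(\<Oplus>\<^bsub>A2\<^esub>k\<in>I. \<one>\<^bsub>A2\<^esub> \<ominus>\<^bsub>A2\<^esub> F k k) = of_nat n \<odot>\<^bsub>A2\<^esub> \<one>\<^bsub>A2\<^esub> \<ominus>\<^bsub>A2\<^esub> (\<Oplus>\<^bsub>A2\<^esub>k\<in>I. F k k)"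
    by (simp add: A2.finsum_minus A2.finsum_const_scale)
  then have "?C = c \<odot>\<^bsub>A2\<^esub> (\<Oplus>\<^bsub>A2\<^esub>k\<in>I. \<one>\<^bsub>A2\<^esub> \<ominus>\<^bsub>A2\<^esub> F k k)"
    by (simp add: C_F A2.scale_minus A2.scale_simps c_nat A2.M.finsum_closed Pi_def)
  also have "\<dots> \<in> A2.order_unit_bounded"
    unfolding c_def using F_proj
    by (intro A2.order_unit_bounded_scale A2.order_unit_bounded_finsum
        A2.projection_order_unit_bounded A2.one_minus_projection) auto
  finally have C_bounded: "?C \<in> A2.order_unit_bounded" .
  then have C_pos: "?C \<in> cstar_pos A2" and C_sa: "?C \<in> cstar_sa A2"
    using A2.order_unit_bounded_subset_cstar_pos A2.order_unit_bounded_sa by auto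

  have leg_t: "\<iota> i j (t a b) = tensor4 t s (\<lambda>m. if m = i then a else if m = j then b else \<one>\<^bsub>A\<^esub>)"
    if "i \<in> {1..4}" "j \<in> {1..4}" "i \<noteq> j" "a \<in> carrier A" "b \<in> carrier A" for i j a b
    using assms(6) that unfolding are_leg_embeddings_def by blast
  \<comment> \<open>In the bracketing by pairs, legs 1 and 2 make up the left argument of
    \<open>s\<close> and legs 3 and 4 the right one. Legs 1 and 3 are the first slots of the two
    pairs, legs 2 and 4 the second slots.\<close>
  have \<iota>12_t: "\<iota> 1 2 (t a b) = s (t a b) \<one>\<^bsub>A2\<^esub>"
    and \<iota>34_t: "\<iota> 3 4 (t a b) = s \<one>\<^bsub>A2\<^esub> (t a b)"
    and \<iota>13_t: "\<iota> 1 3 (t a b) = s (t a \<one>\<^bsub>A\<^esub>) (t b \<one>\<^bsub>A\<^esub>)"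
    and \<iota>24_t: "\<iota> 2 4 (t a b) = s (t \<one>\<^bsub>A\<^esub> a) (t \<one>\<^bsub>A\<^esub> b)"
    if "a \<in> carrier A" "b \<in> carrier A" for a b
    using that by (simp_all add: leg_t tensor4_def t.one)

  \<comment> \<open>keeps simp from turning the leg index in \<open>\<iota> 1 2\<close> into \<open>Suc 0\<close>\<close>
  note One_nat_def [simp del]

  define W where "W k l = s (E k l) (F k l)" for k l
  define X where "X k = s (E k k) \<one>\<^bsub>A2\<^esub>" for k
  define Y where "Y k = s \<one>\<^bsub>A2\<^esub> (F k k)" for k
  \<comment> \<open>Grouping the terms E_kl \<otimes> F_kl by k lets each group be matched with
    \<open>X k\<close> and \<open>Y k\<close>.\<close>
  define Z where "Z k = (\<Oplus>\<^bsub>A4\<^esub>l\<in>I. W k l)" for k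
  have W [simp]: "W k l \<in> carrier A4" if "k \<in> I" "l \<in> I" for k l
    unfolding W_def using that by (intro s.closed) auto
  have X [simp]: "X k \<in> carrier A4" and Y [simp]: "Y k \<in> carrier A4" if "k \<in> I" for k
    unfolding X_def Y_def using that by (auto intro!: s.closed)
  have Z [simp]: "Z k \<in> carrier A4" if "k \<in> I" for k
    unfolding Z_def using that by (intro A4.M.finsum_closed) auto

  have \<iota>12_E: "\<iota> 1 2 (E k k) = X k" if "k \<in> I" for k
  proof -
    have "\<iota> 1 2 (E k k) = (\<Oplus>\<^bsub>A4\<^esub>i\<in>I. \<iota> 1 2 (t (u i k) (u i k)))"
      unfolding E_def using that by (intro \<iota>12.finsum) auto
    also have "\<dots> = (\<Oplus>\<^bsub>A4\<^esub>i\<in>I. s (t (u i k) (u i k)) \<one>\<^bsub>A2\<^esub>)"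
      using that by (intro A4.M.finsum_cong') (auto simp: \<iota>12_t intro!: s.closed)
    also have "\<dots> = X k"
      unfolding E_def X_def using that by (intro s.finsum_left[symmetric]) auto
    finally show ?thesis .
  qed
  have \<iota>34_F: "\<iota> 3 4 (F k k) = Y k" if "k \<in> I" for k
  proof -
    have "\<iota> 3 4 (F k k) = (\<Oplus>\<^bsub>A4\<^esub>j\<in>I. \<iota> 3 4 (t (u k j) (u k j)))"
      unfolding F_def using that by (intro \<iota>34.finsum) auto
    also have "\<dots> = (\<Oplus>\<^bsub>A4\<^esub>j\<in>I. s \<one>\<^bsub>A2\<^esub> (t (u k j) (u k j)))"
      using that by (intro A4.M.finsum_cong') (auto simp: \<iota>34_t intro!: s.closed)
    also have "\<dots> = Y k"
      unfolding F_def Y_def using that by (intro s.finsum_right[symmetric]) auto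
    finally show ?thesis .
  qed
  have \<iota>12_C: "\<iota> 1 2 ?C = \<one>\<^bsub>A4\<^esub> \<ominus>\<^bsub>A4\<^esub> c \<odot>\<^bsub>A4\<^esub> (\<Oplus>\<^bsub>A4\<^esub>k\<in>I. X k)"
  proof -
    have "\<iota> 1 2 (\<Oplus>\<^bsub>A2\<^esub>k\<in>I. E k k) = (\<Oplus>\<^bsub>A4\<^esub>k\<in>I. \<iota> 1 2 (E k k))"
      by (intro \<iota>12.finsum) auto
    also have "\<dots> = (\<Oplus>\<^bsub>A4\<^esub>k\<in>I. X k)"
      by (intro A4.M.finsum_cong') (auto simp: \<iota>12_E)
    finally show ?thesis
      by (simp add: C_E \<iota>12.minus \<iota>12.one \<iota>12.scale A2.M.finsum_closed Pi_def)
  qed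
  have \<iota>34_C: "\<iota> 3 4 ?C = \<one>\<^bsub>A4\<^esub> \<ominus>\<^bsub>A4\<^esub> c \<odot>\<^bsub>A4\<^esub> (\<Oplus>\<^bsub>A4\<^esub>k\<in>I. Y k)"
  proof -
    have "\<iota> 3 4 (\<Oplus>\<^bsub>A2\<^esub>k\<in>I. F k k) = (\<Oplus>\<^bsub>A4\<^esub>k\<in>I. \<iota> 3 4 (F k k))"
      by (intro \<iota>34.finsum) auto
    also have "\<dots> = (\<Oplus>\<^bsub>A4\<^esub>k\<in>I. Y k)"
      by (intro A4.M.finsum_cong') (auto simp: \<iota>34_F)
    finally show ?thesis
      by (simp add: C_F \<iota>34.minus \<iota>34.one \<iota>34.scale A2.M.finsum_closed Pi_def)
  qed

  define V where "V i j k l = s (t (u i k) (u i l)) (t (u k j) (u l j))" for i j k l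
  have V [simp]: "V i j k l \<in> carrier A4" if "i \<in> I" "j \<in> I" "k \<in> I" "l \<in> I" for i j k l
    unfolding V_def using that by (intro s.closed) auto
  have t1 [simp]: "t a \<one>\<^bsub>A\<^esub> \<in> carrier A2" "t \<one>\<^bsub>A\<^esub> a \<in> carrier A2" if "a \<in> carrier A" for a
    using that by (auto intro: t.closed)
  have \<Delta>_u: "\<Delta> (u i j) = (\<Oplus>\<^bsub>A2\<^esub>k\<in>I. t (u i k) (u k j))" if "i \<in> I" "j \<in> I" for i j
    using assms(5) that unfolding is_comultiplication_def I_def by blast
  have \<Delta>t_tu: "\<Delta>t (t (u i j) (u i j)) = (\<Oplus>\<^bsub>A4\<^esub>k\<in>I. \<Oplus>\<^bsub>A4\<^esub>l\<in>I. V i j k l)"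
    if i: "i \<in> I" and j: "j \<in> I" for i j
  proof -
    have "\<iota> 1 3 (\<Delta> (u i j)) = (\<Oplus>\<^bsub>A4\<^esub>k\<in>I. \<iota> 1 3 (t (u i k) (u k j)))"
      unfolding \<Delta>_u[OF i j] using i j by (intro \<iota>13.finsum) auto
    also have "\<dots> = (\<Oplus>\<^bsub>A4\<^esub>k\<in>I. s (t (u i k) \<one>\<^bsub>A\<^esub>) (t (u k j) \<one>\<^bsub>A\<^esub>))"
      using i j by (intro A4.M.finsum_cong') (auto simp: \<iota>13_t intro!: s.closed)
    finally have 13: "\<iota> 1 3 (\<Delta> (u i j)) = \<dots>" .
    have "\<iota> 2 4 (\<Delta> (u i j)) = (\<Oplus>\<^bsub>A4\<^esub>l\<in>I. \<iota> 2 4 (t (u i l) (u l j)))"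
      unfolding \<Delta>_u[OF i j] using i j by (intro \<iota>24.finsum) auto
    also have "\<dots> = (\<Oplus>\<^bsub>A4\<^esub>l\<in>I. s (t \<one>\<^bsub>A\<^esub> (u i l)) (t \<one>\<^bsub>A\<^esub> (u l j)))"
      using i j by (intro A4.M.finsum_cong') (auto simp: \<iota>24_t intro!: s.closed)
    finally have 24: "\<iota> 2 4 (\<Delta> (u i j)) = \<dots>" .
    \<comment> \<open>\<open>\<Delta>t\<close> is prescribed only on a \<otimes> 1 and 1 \<otimes>
      a, so its value at a \<otimes> b is obtained from this factorization.\<close>
    have split: "t a \<one>\<^bsub>A\<^esub> \<otimes>\<^bsub>A2\<^esub> t \<one>\<^bsub>A\<^esub> b = t a b" if "a \<in> carrier A" "b \<in> carrier A" for a b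
      using that t.mult[of a "\<one>\<^bsub>A\<^esub>" "\<one>\<^bsub>A\<^esub>" b] by simp
    have "\<Delta>t (t (u i j) (u i j)) = \<Delta>t (t (u i j) \<one>\<^bsub>A\<^esub>) \<otimes>\<^bsub>A4\<^esub> \<Delta>t (t \<one>\<^bsub>A\<^esub> (u i j))"
      using i j by (simp add: split flip: \<Delta>t.mult)
    also have "\<dots> = \<iota> 1 3 (\<Delta> (u i j)) \<otimes>\<^bsub>A4\<^esub> \<iota> 2 4 (\<Delta> (u i j))"
      using assms(7) i j by (simp add: is_Delta_tilde_def)
    also have "\<dots> = (\<Oplus>\<^bsub>A4\<^esub>k\<in>I. \<Oplus>\<^bsub>A4\<^esub>l\<in>I. s (t (u i k) \<one>\<^bsub>A\<^esub>) (t (u k j) \<one>\<^bsub>A\<^esub>)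
        \<otimes>\<^bsub>A4\<^esub> s (t \<one>\<^bsub>A\<^esub> (u i l)) (t \<one>\<^bsub>A\<^esub> (u l j)))"
      unfolding 13 24 using i j by (intro A4.finsum_mult) (auto intro!: s.closed)
    \<comment> \<open>Multiplying within each pair of legs applies \<open>split\<close> once to the
      left and once to the right argument of \<open>s\<close>.\<close>
    also have "\<dots> = (\<Oplus>\<^bsub>A4\<^esub>k\<in>I. \<Oplus>\<^bsub>A4\<^esub>l\<in>I. V i j k l)"
      using i j by (intro A4.M.finsum_cong')
        (auto simp: V_def split simp flip: s.mult intro!: A4.M.finsum_closed s.closed)
    finally show ?thesis .
  qed
  have "(\<Oplus>\<^bsub>A4\<^esub>k\<in>I. Z k) = (\<Oplus>\<^bsub>A4\<^esub>k\<in>I. \<Oplus>\<^bsub>A4\<^esub>l\<in>I. \<Oplus>\<^bsub>A4\<^esub>i\<in>I. \<Oplus>\<^bsub>A4\<^esub>j\<in>I. V i j k l)"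
    unfolding Z_def
  proof (intro A4.M.finsum_cong')
    fix k l assume "k \<in> I" "l \<in> I"
    then show "W k l = (\<Oplus>\<^bsub>A4\<^esub>i\<in>I. \<Oplus>\<^bsub>A4\<^esub>j\<in>I. V i j k l)"
      unfolding W_def E_def F_def V_def by (intro s.finsum_both) auto
  qed (auto intro!: A4.M.finsum_closed)
  \<comment> \<open>First i moves to the front, then j moves to second place, so that the inner sums
    over k and l become values of \<open>\<Delta>t\<close>.\<close>
  also have "\<dots> = (\<Oplus>\<^bsub>A4\<^esub>i\<in>I. \<Oplus>\<^bsub>A4\<^esub>k\<in>I. \<Oplus>\<^bsub>A4\<^esub>l\<in>I. \<Oplus>\<^bsub>A4\<^esub>j\<in>I. V i j k l)"
    by (intro A4.finsum_rotate) (auto intro!: A4.M.finsum_closed)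
  also have "\<dots> = (\<Oplus>\<^bsub>A4\<^esub>i\<in>I. \<Oplus>\<^bsub>A4\<^esub>j\<in>I. \<Oplus>\<^bsub>A4\<^esub>k\<in>I. \<Oplus>\<^bsub>A4\<^esub>l\<in>I. V i j k l)"
    by (intro A4.M.finsum_cong' A4.finsum_rotate) (auto intro!: A4.M.finsum_closed)
  also have "\<dots> = (\<Oplus>\<^bsub>A4\<^esub>i\<in>I. \<Oplus>\<^bsub>A4\<^esub>j\<in>I. \<Delta>t (t (u i j) (u i j)))"
    by (intro A4.M.finsum_cong') (auto simp: \<Delta>t_tu intro!: A4.M.finsum_closed \<Delta>t.closed)
  also have "\<dots> = (\<Oplus>\<^bsub>A4\<^esub>i\<in>I. \<Delta>t (F i i))"
    by (intro A4.M.finsum_cong')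
      (auto simp: F_def intro!: \<Delta>t.finsum[symmetric] \<Delta>t.closed A2.M.finsum_closed)
  also have "\<dots> = \<Delta>t (\<Oplus>\<^bsub>A2\<^esub>i\<in>I. F i i)"
    by (intro \<Delta>t.finsum[symmetric]) auto
  finally have \<Delta>t_C: "\<Delta>t ?C = \<one>\<^bsub>A4\<^esub> \<ominus>\<^bsub>A4\<^esub> c \<odot>\<^bsub>A4\<^esub> (\<Oplus>\<^bsub>A4\<^esub>k\<in>I. Z k)"
    by (simp add: C_F \<Delta>t.minus \<Delta>t.one \<Delta>t.scale A2.M.finsum_closed Pi_def)

  \<comment> \<open>The constant 1 is spread over the n values of k; it is recovered at the end from
    c n = 1.\<close>
  define H where "H k = (\<one>\<^bsub>A4\<^esub> \<ominus>\<^bsub>A4\<^esub> X k \<ominus>\<^bsub>A4\<^esub> Y k) \<oplus>\<^bsub>A4\<^esub> Z k" for k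
  have H_bounded: "H k \<in> A4.order_unit_bounded" if k: "k \<in> I" for k
  proof -
    \<comment> \<open>Once the term l = k is split off to complete the product of complements, the
      remainder consists of projections only.\<close>
    define R where "R = (\<Oplus>\<^bsub>A4\<^esub>l\<in>I - {k}. W k l)"
    have "R \<in> carrier A4" unfolding R_def using k by (intro A4.M.finsum_closed) auto
    have "Z k = W k k \<oplus>\<^bsub>A4\<^esub> R"
      using A4.M.finsum_insert[of "I - {k}" k "W k"] k
      by (simp add: Z_def R_def insert_absorb Pi_def)
    then have "H k = s (\<one>\<^bsub>A2\<^esub> \<ominus>\<^bsub>A2\<^esub> E k k) (\<one>\<^bsub>A2\<^esub> \<ominus>\<^bsub>A2\<^esub> F k k) \<oplus>\<^bsub>A4\<^esub> R"
      using k \<open>R \<in> carrier A4\<close>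
      by (simp add: s.tensor_complements H_def A4.M.a_assoc flip: X_def Y_def W_def)
    moreover have "R \<in> A4.order_unit_bounded"
      unfolding R_def W_def using k E_proj F_proj
      by (intro A4.order_unit_bounded_finsum A4.projection_order_unit_bounded s.tensor_projection) auto
    moreover have "s (\<one>\<^bsub>A2\<^esub> \<ominus>\<^bsub>A2\<^esub> E k k) (\<one>\<^bsub>A2\<^esub> \<ominus>\<^bsub>A2\<^esub> F k k) \<in> A4.order_unit_bounded"
      using k E_proj F_proj
      by (intro A4.projection_order_unit_bounded s.tensor_projection A2.one_minus_projection)
    ultimately show ?thesis
      by (simp add: A4.order_unit_bounded_add)
  qed
  have "(\<Oplus>\<^bsub>A4\<^esub>k\<in>I. H k) = (\<Oplus>\<^bsub>A4\<^esub>k\<in>I. \<one>\<^bsub>A4\<^esub> \<ominus>\<^bsub>A4\<^esub> X k \<ominus>\<^bsub>A4\<^esub> Y k) \<oplus>\<^bsub>A4\<^esub> (\<Oplus>\<^bsub>A4\<^esub>k\<in>I. Z k)"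
    unfolding H_def by (intro A4.M.finsum_addf) auto
  also have "\<dots> = (of_nat n \<odot>\<^bsub>A4\<^esub> \<one>\<^bsub>A4\<^esub> \<ominus>\<^bsub>A4\<^esub> (\<Oplus>\<^bsub>A4\<^esub>k\<in>I. X k) \<ominus>\<^bsub>A4\<^esub> (\<Oplus>\<^bsub>A4\<^esub>k\<in>I. Y k))
      \<oplus>\<^bsub>A4\<^esub> (\<Oplus>\<^bsub>A4\<^esub>k\<in>I. Z k)"
    by (simp add: A4.finsum_minus A4.finsum_const_scale)
  finally have "c \<odot>\<^bsub>A4\<^esub> (\<Oplus>\<^bsub>A4\<^esub>k\<in>I. H k) = (\<one>\<^bsub>A4\<^esub> \<ominus>\<^bsub>A4\<^esub> c \<odot>\<^bsub>A4\<^esub> (\<Oplus>\<^bsub>A4\<^esub>k\<in>I. X k)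
      \<ominus>\<^bsub>A4\<^esub> c \<odot>\<^bsub>A4\<^esub> (\<Oplus>\<^bsub>A4\<^esub>k\<in>I. Y k)) \<oplus>\<^bsub>A4\<^esub> c \<odot>\<^bsub>A4\<^esub> (\<Oplus>\<^bsub>A4\<^esub>k\<in>I. Z k)"
    by (simp add: A4.scale_add A4.scale_minus A4.scale_simps c_nat A4.M.finsum_closed Pi_def)
  \<comment> \<open>The units balance as 1 + 1 - 1 = 1: two from the leg embeddings of C_H and one
    from \<open>\<Delta>t\<close> of it.\<close>
  moreover have "(\<one>\<^bsub>A4\<^esub> \<ominus>\<^bsub>A4\<^esub> x \<ominus>\<^bsub>A4\<^esub> y) \<oplus>\<^bsub>A4\<^esub> z
      = ((\<one>\<^bsub>A4\<^esub> \<ominus>\<^bsub>A4\<^esub> x) \<oplus>\<^bsub>A4\<^esub> (\<one>\<^bsub>A4\<^esub> \<ominus>\<^bsub>A4\<^esub> y)) \<ominus>\<^bsub>A4\<^esub> (\<one>\<^bsub>A4\<^esub> \<ominus>\<^bsub>A4\<^esub> z)"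
    if "x \<in> carrier A4" "y \<in> carrier A4" "z \<in> carrier A4" for x y z
    using that by algebra
  ultimately have "(\<iota> 1 2 ?C \<oplus>\<^bsub>A4\<^esub> \<iota> 3 4 ?C) \<ominus>\<^bsub>A4\<^esub> \<Delta>t ?C = c \<odot>\<^bsub>A4\<^esub> (\<Oplus>\<^bsub>A4\<^esub>k\<in>I. H k)"
    by (simp add: \<iota>12_C \<iota>34_C \<Delta>t_C A4.M.finsum_closed Pi_def)
  also have "\<dots> \<in> A4.order_unit_bounded"
    unfolding c_def using H_bounded
    by (intro A4.order_unit_bounded_scale A4.order_unit_bounded_finsum) auto
  finally have "(\<iota> 1 2 ?C \<oplus>\<^bsub>A4\<^esub> \<iota> 3 4 ?C) \<ominus>\<^bsub>A4\<^esub> \<Delta>t ?C \<in> cstar_pos A4"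
    using A4.order_unit_bounded_subset_cstar_pos by blast
  moreover have "\<iota> 1 2 ?C \<oplus>\<^bsub>A4\<^esub> \<iota> 3 4 ?C \<in> cstar_sa A4"
    using \<iota>12.sa[OF C_sa] \<iota>34.sa[OF C_sa] by (simp add: cstar_sa_def A4.adj_add)
  ultimately show ?thesis
    using C_pos \<Delta>t.sa[OF C_sa] by (simp add: cstar_le_def)
qed

end
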